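(* Let $\mathcal{A}$ be an arrangement in $V=\mathbb{K}^\ell$, $H\in\mathcal{A}$, $\mathcal{A}'=\mathcal{A}\setminus\{H\}$. Assume that $\operatorname{pd}\mathcal{A}'=0$. Then the Euler restriction map $\rho^H:D(\mathcal{A})\to D(\mathcal{A}^H)$ is surjective.
   Context: $\mathbb{K}$ is an arbitrary field, $V=\mathbb{K}^\ell$, $S=\mathrm{Sym}^*(V^* )\simeq\mathbb{K}[x_1,\dots,x_\ell]$, $\mathrm{Der}\,S=\bigoplus_{i=1}^\ell S\partial_{x_i}$. An arrangement $\mathcal{A}$ in $V$ is a finite set of linear hyperplanes; for $L\in\mathcal{A}$ fix a linear form $\alpha_L$ with $\ker\alpha_L=L$. $D(\mathcal{A})=\{\theta\in\mathrm{Der}\,S\mid\theta(\alpha_L)\in S\alpha_L\ \forall L\in\mathcal{A}\}$ is a graded $S$-module, and $\operatorname{pd}\mathcal{A}:=\operatorname{pd}_S D(\mathcal{A})$. $\mathcal{A}^H=\{H\cap L\mid L\in\mathcal{A}\setminus\{H\}\}$ is an arrangement in $H\simeq\mathbb{K}^{\ell-1}$ with coordinate ring $S^H=S/\alpha_HS$, and $D(\mathcal{A}^H)\subset\mathrm{Der}\,S^H$ is defined in the same way. The Euler restriction map $\rho^H$ is reduction modulo $\alpha_H$: $\rho^H(\theta)(\overline f)=\overline{\theta(f)}$, where $\overline f\in S^H$ is the image of $f\in S$. *)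

theory Defs
  imports
    "HOL-Analysis.Cartesian_Space"
    "HOL-Algebra.Algebraic_Closure_Type"
    "HOL-Algebra.QuotRing"
    "HOL-Algebra.Module"
    "HOL-Library.Extended_Nat"
    "HOL-Library.Poly_Mapping"
begin

section \<open>Projective dimension\<close>

definition mod_hom ::
  "('r, 'c) ring_scheme \<Rightarrow> ('r, 'm, 'd) module_scheme \<Rightarrow> ('r, 'p, 'e) module_scheme \<Rightarrow> ('m \<Rightarrow> 'p) set"
  where "mod_hom R M N = {h \<in> carrier M \<rightarrow> carrier N.
    (\<forall>x\<in>carrier M. \<forall>y\<in>carrier M. h (x \<oplus>\<^bsub>M\<^esub> y) = h x \<oplus>\<^bsub>N\<^esub> h y) \<and>
    (\<forall>a\<in>carrier R. \<forall>x\<in>carrier M. h (a \<odot>\<^bsub>M\<^esub> x) = a \<odot>\<^bsub>N\<^esub> h x)}"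

text \<open>The ring multiplication fields of a module record play no role and are left undefined.\<close>

definition free_module :: "('r, 'c) ring_scheme \<Rightarrow> 'b set \<Rightarrow> ('r, 'b \<Rightarrow> 'r) module"
  where "free_module R B = \<lparr>
    carrier = {f. (\<forall>b. f b \<in> carrier R) \<and> (\<forall>b. b \<notin> B \<longrightarrow> f b = \<zero>\<^bsub>R\<^esub>) \<and> finite {b. f b \<noteq> \<zero>\<^bsub>R\<^esub>}},
    monoid.mult = undefined, monoid.one = undefined,
    ring.zero = (\<lambda>_. \<zero>\<^bsub>R\<^esub>), ring.add = (\<lambda>f g b. f b \<oplus>\<^bsub>R\<^esub> g b),
    module.smult = (\<lambda>a f b. a \<otimes>\<^bsub>R\<^esub> f b)\<rparr>"

text \<open>Projective means direct summand (retract) of a free module.  Basis sets \<open>B\<close> inside the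
  element type of \<open>M\<close> suffice: if \<open>M\<close> is a retract of any free module, then the canonical
  surjection onto \<open>M\<close> from the free module with basis \<open>carrier M\<close> splits.\<close>

definition projective_module :: "('r, 'c) ring_scheme \<Rightarrow> ('r, 'm, 'd) module_scheme \<Rightarrow> bool"
  where "projective_module R M \<longleftrightarrow> Module.module R M \<and>
    (\<exists>(B :: 'm set) \<iota> \<pi>. \<iota> \<in> mod_hom R M (free_module R B) \<and>
       \<pi> \<in> mod_hom R (free_module R B) M \<and> (\<forall>x\<in>carrier M. \<pi> (\<iota> x) = x))"

text \<open>The complex \<open>\<dots> \<rightarrow> P 1 \<rightarrow> P 0 \<rightarrow> M \<rightarrow> 0\<close>, with maps \<open>d i : P (i + 1) \<rightarrow> P i\<close> and
  augmentation \<open>e : P 0 \<rightarrow> M\<close>, is exact and all \<open>P i\<close> are projective.\<close>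

definition projective_resolution ::
  "('r, 'c) ring_scheme \<Rightarrow> ('r, 'm, 'd) module_scheme \<Rightarrow>
   (nat \<Rightarrow> ('r, 'p) module) \<Rightarrow> (nat \<Rightarrow> 'p \<Rightarrow> 'p) \<Rightarrow> ('p \<Rightarrow> 'm) \<Rightarrow> bool"
  where "projective_resolution R M P d e \<longleftrightarrow>
    (\<forall>i. projective_module R (P i)) \<and>
    (\<forall>i. d i \<in> mod_hom R (P (Suc i)) (P i)) \<and>
    e \<in> mod_hom R (P 0) M \<and>
    e ` carrier (P 0) = carrier M \<and>
    d 0 ` carrier (P 1) = {x \<in> carrier (P 0). e x = \<zero>\<^bsub>M\<^esub>} \<and>
    (\<forall>i. d (Suc i) ` carrier (P (Suc (Suc i))) =
         {x \<in> carrier (P (Suc i)). d i x = \<zero>\<^bsub>P i\<^esub>})"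

text \<open>Infimum of the lengths of projective resolutions, \<open>\<infinity>\<close> if there is no finite one (the zero
  module gets dimension \<open>0\<close>).  HOL definitions cannot quantify over types, so the modules of a
  resolution live in the fixed type \<open>('m \<times> 'r) list \<Rightarrow> 'r\<close>.  It is large enough for every \<open>M\<close>: a free
  module on \<open>carrier M\<close> has at most as many elements as \<open>('m \<times> 'r) list\<close>, so in each step of the
  usual construction the next free module, and the kernels in it, can be found in this type.\<close>

definition proj_dim :: "('r, 'c) ring_scheme \<Rightarrow> ('r, 'm, 'd) module_scheme \<Rightarrow> enat"
  where "proj_dim R M = (INF n \<in> {n :: nat.
    \<exists>(P :: nat \<Rightarrow> ('r, ('m \<times> 'r) list \<Rightarrow> 'r) module) d e.
      projective_resolution R M P d e \<and> (\<forall>i>n. carrier (P i) = {\<zero>\<^bsub>P i\<^esub>})}. enat n)"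


section \<open>Derivations\<close>

text \<open>\<open>c\<close> is the structure map of the algebra \<open>R\<close> over the field \<open>'k\<close>.  Derivations are
  functions on \<open>carrier R\<close>, normalised to be extensional.\<close>

definition derivations :: "('r, 'c) ring_scheme \<Rightarrow> ('k \<Rightarrow> 'r) \<Rightarrow> ('r \<Rightarrow> 'r) set"
  where "derivations R c = {\<theta> \<in> carrier R \<rightarrow>\<^sub>E carrier R.
    (\<forall>f\<in>carrier R. \<forall>g\<in>carrier R. \<theta> (f \<oplus>\<^bsub>R\<^esub> g) = \<theta> f \<oplus>\<^bsub>R\<^esub> \<theta> g) \<and>
    (\<forall>f\<in>carrier R. \<forall>g\<in>carrier R.
       \<theta> (f \<otimes>\<^bsub>R\<^esub> g) = (f \<otimes>\<^bsub>R\<^esub> \<theta> g) \<oplus>\<^bsub>R\<^esub> (g \<otimes>\<^bsub>R\<^esub> \<theta> f)) \<and>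
    (\<forall>k. \<theta> (c k) = \<zero>\<^bsub>R\<^esub>)}"

definition log_derivations :: "('r, 'c) ring_scheme \<Rightarrow> ('k \<Rightarrow> 'r) \<Rightarrow> 'r set \<Rightarrow> ('r \<Rightarrow> 'r) set"
  where "log_derivations R c F = {\<theta> \<in> derivations R c. \<forall>a\<in>F. \<theta> a \<in> PIdl\<^bsub>R\<^esub> a}"

definition log_derivation_module ::
  "('r, 'c) ring_scheme \<Rightarrow> ('k \<Rightarrow> 'r) \<Rightarrow> 'r set \<Rightarrow> ('r, 'r \<Rightarrow> 'r) module"
  where "log_derivation_module R c F = \<lparr>
    carrier = log_derivations R c F,
    monoid.mult = undefined, monoid.one = undefined,
    ring.zero = (\<lambda>x\<in>carrier R. \<zero>\<^bsub>R\<^esub>), ring.add = (\<lambda>\<theta> \<eta>. \<lambda>x\<in>carrier R. \<theta> x \<oplus>\<^bsub>R\<^esub> \<eta> x),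
    module.smult = (\<lambda>a \<theta>. \<lambda>x\<in>carrier R. a \<otimes>\<^bsub>R\<^esub> \<theta> x)\<rparr>"


section \<open>Hyperplane arrangements in \<open>'k ^ 'n\<close>\<close>

definition hyperplane :: "('k::field ^ 'n) set \<Rightarrow> bool"
  where "hyperplane L \<longleftrightarrow> vec.subspace L \<and> vec.dim L + 1 = CARD('n)"

definition arrangement :: "('k::field ^ 'n) set set \<Rightarrow> bool"
  where "arrangement A \<longleftrightarrow> finite A \<and> (\<forall>L\<in>A. hyperplane L)"

definition restr_arrangement :: "('k::field ^ 'n) set set \<Rightarrow> ('k ^ 'n) set \<Rightarrow> ('k ^ 'n) set set"
  where "restr_arrangement A H = {H \<inter> L | L. L \<in> A - {H}}"

text \<open>The restriction of the linear form \<open>\<phi>\<close> to the subspace \<open>W\<close> has kernel \<open>Z\<close>.  Every linear form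
  on \<open>W\<close> is such a restriction.\<close>

definition defining_form :: "('k::field ^ 'n) set \<Rightarrow> ('k ^ 'n \<Rightarrow> 'k) \<Rightarrow> ('k ^ 'n) set \<Rightarrow> bool"
  where "defining_form W \<phi> Z \<longleftrightarrow> Vector_Spaces.linear (*s) (*) \<phi> \<and> {v \<in> W. \<phi> v = 0} = Z"

text \<open>Polynomials in variables indexed by \<open>'n\<close>: finitely supported maps from exponent vectors
  to coefficients.\<close>

type_synonym ('k, 'n) mpoly = "('n \<Rightarrow>\<^sub>0 nat) \<Rightarrow>\<^sub>0 'k"

abbreviation SV :: "('k::field, 'n::finite) mpoly ring"
  where "SV \<equiv> ring_of_type_algebra"

definition const_poly :: "'k \<Rightarrow> ('k::field, 'n::finite) mpoly"
  where "const_poly k = Poly_Mapping.single 0 k"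

definition var_poly :: "'n \<Rightarrow> ('k::field, 'n::finite) mpoly"
  where "var_poly i = Poly_Mapping.single (Poly_Mapping.single i 1) 1"

text \<open>The embedding of the dual space into the symmetric algebra; \<open>axis i 1\<close> is the \<open>i\<close>-th standard
  basis vector.\<close>

definition form_poly :: "('k ^ 'n \<Rightarrow> 'k) \<Rightarrow> ('k::field, 'n::finite) mpoly"
  where "form_poly \<phi> = (\<Sum>i\<in>UNIV. const_poly (\<phi> (axis i 1)) * var_poly i)"

definition D_arr :: "(('k ^ 'n) set \<Rightarrow> 'k ^ 'n \<Rightarrow> 'k) \<Rightarrow> ('k ^ 'n) set set \<Rightarrow>
    (('k::field, 'n::finite) mpoly \<Rightarrow> ('k, 'n) mpoly) set"
  where "D_arr \<alpha> A = log_derivations SV const_poly ((\<lambda>L. form_poly (\<alpha> L)) ` A)"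

definition D_arr_module :: "(('k ^ 'n) set \<Rightarrow> 'k ^ 'n \<Rightarrow> 'k) \<Rightarrow> ('k ^ 'n) set set \<Rightarrow>
    (('k::field, 'n::finite) mpoly, ('k, 'n) mpoly \<Rightarrow> ('k, 'n) mpoly) module"
  where "D_arr_module \<alpha> A = log_derivation_module SV const_poly ((\<lambda>L. form_poly (\<alpha> L)) ` A)"

definition pd_arr :: "(('k ^ 'n) set \<Rightarrow> 'k ^ 'n \<Rightarrow> 'k) \<Rightarrow> ('k::field ^ 'n::finite) set set \<Rightarrow> enat"
  where "pd_arr \<alpha> A = proj_dim SV (D_arr_module \<alpha> A)"


section \<open>The restriction to a hyperplane\<close>

text \<open>\<open>\<phi>\<close> is the form defining the hyperplane \<open>H\<close>; the coordinate ring of \<open>H\<close> is \<open>SV\<close> modulo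
  \<open>\<phi>\<close>, and \<open>\<beta> Z\<close> is a form on the whole space whose restriction to \<open>H\<close> has kernel \<open>Z\<close>.\<close>

definition form_ideal :: "('k ^ 'n \<Rightarrow> 'k) \<Rightarrow> ('k::field, 'n::finite) mpoly set"
  where "form_ideal \<phi> = PIdl\<^bsub>SV\<^esub> (form_poly \<phi>)"

definition reduce :: "('k ^ 'n \<Rightarrow> 'k) \<Rightarrow> ('k::field, 'n::finite) mpoly \<Rightarrow> ('k, 'n) mpoly set"
  where "reduce \<phi> f = form_ideal \<phi> +>\<^bsub>SV\<^esub> f"

definition SH :: "('k ^ 'n \<Rightarrow> 'k) \<Rightarrow> ('k::field, 'n::finite) mpoly set ring"
  where "SH \<phi> = SV Quot (form_ideal \<phi>)"

definition D_restr :: "('k ^ 'n \<Rightarrow> 'k) \<Rightarrow> (('k ^ 'n) set \<Rightarrow> 'k ^ 'n \<Rightarrow> 'k) \<Rightarrow> ('k ^ 'n) set set \<Rightarrow>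
    (('k::field, 'n::finite) mpoly set \<Rightarrow> ('k, 'n) mpoly set) set"
  where "D_restr \<phi> \<beta> B = log_derivations (SH \<phi>) (\<lambda>k. reduce \<phi> (const_poly k))
    ((\<lambda>Z. reduce \<phi> (form_poly (\<beta> Z))) ` B)"

text \<open>The union over the representatives \<open>f\<close> of the class \<open>Y\<close> has only one member when \<open>\<theta>\<close>
  preserves the ideal, see \<open>euler_restriction_reduce\<close> below.\<close>

definition euler_restriction :: "('k ^ 'n \<Rightarrow> 'k) \<Rightarrow>
    (('k::field, 'n::finite) mpoly \<Rightarrow> ('k, 'n) mpoly) \<Rightarrow>
    (('k, 'n) mpoly set \<Rightarrow> ('k, 'n) mpoly set)"
  where "euler_restriction \<phi> \<theta> = (\<lambda>Y\<in>carrier (SH \<phi>). \<Union>f\<in>Y. reduce \<phi> (\<theta> f))"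


section \<open>Sanity checks\<close>

lemma SV_simps [simp]:
  "carrier SV = UNIV" "x \<oplus>\<^bsub>SV\<^esub> y = x + y" "x \<otimes>\<^bsub>SV\<^esub> y = x * y" "\<zero>\<^bsub>SV\<^esub> = 0" "\<one>\<^bsub>SV\<^esub> = 1"
  by (simp_all add: ring_of_type_algebra_def)

lemma derivations_SV_iff:
  "\<theta> \<in> derivations SV const_poly \<longleftrightarrow> (\<forall>f g. \<theta> (f + g) = \<theta> f + \<theta> g) \<and>
     (\<forall>f g. \<theta> (f * g) = f * \<theta> g + g * \<theta> f) \<and> (\<forall>k. \<theta> (const_poly k) = 0)"
  by (auto simp: derivations_def)

lemma form_ideal_iff: "x \<in> form_ideal \<phi> \<longleftrightarrow> form_poly \<phi> dvd x"
  by (auto simp: form_ideal_def cgenideal_def dvd_def mult.commute)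

lemma reduce_eq: "reduce \<phi> f = {x + f | x. x \<in> form_ideal \<phi>}"
  by (auto simp: reduce_def a_r_coset_def')

lemma reduce_eq_iff: "reduce \<phi> f = reduce \<phi> g \<longleftrightarrow> form_poly \<phi> dvd f - g"
proof
  assume "reduce \<phi> f = reduce \<phi> g"
  moreover have "f \<in> reduce \<phi> f"
    unfolding reduce_eq form_ideal_iff by (rule CollectI, rule exI [of _ 0]) simp
  ultimately show "form_poly \<phi> dvd f - g"
    by (auto simp: reduce_eq form_ideal_iff)
next
  assume d: "form_poly \<phi> dvd f - g"
  have *: "reduce \<phi> f' \<subseteq> reduce \<phi> g'" if "form_poly \<phi> dvd f' - g'" for f' g'
  proof
    fix y assume "y \<in> reduce \<phi> f'"
    then obtain x where "form_poly \<phi> dvd x" "y = x + f'"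
      by (auto simp: reduce_eq form_ideal_iff)
    with that have "form_poly \<phi> dvd x + (f' - g')" "y = (x + (f' - g')) + g'"
      by (auto intro: dvd_add)
    then show "y \<in> reduce \<phi> g'" unfolding reduce_eq form_ideal_iff by blast
  qed
  have "form_poly \<phi> dvd g - f" using d by (metis dvd_minus_iff minus_diff_eq)
  with d * show "reduce \<phi> f = reduce \<phi> g" by blast
qed

lemma reduce_in_SH: "reduce \<phi> f \<in> carrier (SH \<phi>)"
  by (auto simp: SH_def FactRing_def A_RCOSETS_def' reduce_def)

lemma euler_restriction_reduce:
  assumes \<theta>: "\<theta> \<in> D_arr \<alpha> A" and "H \<in> A"
  shows "euler_restriction (\<alpha> H) \<theta> (reduce (\<alpha> H) f) = reduce (\<alpha> H) (\<theta> f)"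
proof -
  let ?a = "form_poly (\<alpha> H)"
  have d: "\<theta> \<in> derivations SV const_poly" and "\<theta> ?a \<in> form_ideal (\<alpha> H)"
    using assms by (auto simp: D_arr_def log_derivations_def form_ideal_def)
  then have a: "?a dvd \<theta> ?a" by (simp add: form_ideal_iff)
  have const: "reduce (\<alpha> H) (\<theta> g) = reduce (\<alpha> H) (\<theta> f)" if g: "g \<in> reduce (\<alpha> H) f" for g
  proof -
    obtain q where q: "g = ?a * q + f"
      using g by (auto simp: reduce_eq form_ideal_iff dvd_def)
    have "\<theta> g = (?a * \<theta> q + q * \<theta> ?a) + \<theta> f"
      using d unfolding q derivations_SV_iff by simp
    then have "\<theta> g - \<theta> f = ?a * \<theta> q + q * \<theta> ?a" by simp
    then show ?thesis using a by (simp add: reduce_eq_iff)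
  qed
  have "f \<in> reduce (\<alpha> H) f"
    unfolding reduce_eq form_ideal_iff by (rule CollectI, rule exI [of _ 0]) simp
  then have "(\<Union>g\<in>reduce (\<alpha> H) f. reduce (\<alpha> H) (\<theta> g)) = reduce (\<alpha> H) (\<theta> f)"
    by (intro SUP_eq_const) (blast, rule const)
  then show ?thesis
    by (simp add: euler_restriction_def reduce_in_SH)
qed

lemma module_D_arr: "Module.module SV (D_arr_module \<alpha> A)"
proof -
  have D: "\<theta> \<in> carrier (D_arr_module \<alpha> A) \<longleftrightarrow>
      (\<forall>f g. \<theta> (f + g) = \<theta> f + \<theta> g) \<and> (\<forall>f g. \<theta> (f * g) = f * \<theta> g + g * \<theta> f) \<and>
      (\<forall>k. \<theta> (const_poly k) = 0) \<and>
      (\<forall>L\<in>A. form_poly (\<alpha> L) dvd \<theta> (form_poly (\<alpha> L)))" for \<theta>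
    by (simp add: D_arr_module_def log_derivation_module_def log_derivations_def
        form_ideal_def [symmetric] form_ideal_iff derivations_SV_iff)
  have ops: "x \<oplus>\<^bsub>D_arr_module \<alpha> A\<^esub> y = (\<lambda>f. x f + y f)" "\<zero>\<^bsub>D_arr_module \<alpha> A\<^esub> = (\<lambda>f. 0)"
    "a \<odot>\<^bsub>D_arr_module \<alpha> A\<^esub> x = (\<lambda>f. a * x f)" for x y a
    by (simp_all add: D_arr_module_def log_derivation_module_def restrict_def)
  show ?thesis
  proof (rule Module.moduleI, goal_cases)
    case 1 show ?case by (rule cring_from_type_algebra)
  next
    case 2 show ?case
    proof (rule abelian_groupI, goal_cases)
      case (6 x)
      then have "(\<lambda>f. - x f) \<in> carrier (D_arr_module \<alpha> A)"
        unfolding D by (simp add: algebra_simps)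
      then show ?case
        by (intro bexI [of _ "\<lambda>f. - x f"]) (simp_all add: ops)
    qed (simp_all add: D ops algebra_simps)
  qed (simp_all add: D ops algebra_simps)
qed

text \<open>The derivations of the polynomial ring are the free module on the partial derivatives.\<close>

definition partial :: "'n \<Rightarrow> ('k::field, 'n::finite) mpoly \<Rightarrow> ('k, 'n) mpoly"
  where "partial i f = (\<Sum>m\<in>Poly_Mapping.keys f. Poly_Mapping.single (m - Poly_Mapping.single i 1)
           (of_nat (Poly_Mapping.lookup m i) * Poly_Mapping.lookup f m))"

lemma partial_single:
  "partial i (Poly_Mapping.single m c) =
     Poly_Mapping.single (m - Poly_Mapping.single i 1) (of_nat (Poly_Mapping.lookup m i) * c)"
  by (cases "c = 0") (simp_all add: partial_def)

lemma partial_add: "partial i (f + g) = partial i f + partial i g"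
proof -
  let ?t = "\<lambda>h m. Poly_Mapping.single (m - Poly_Mapping.single i 1)
           (of_nat (Poly_Mapping.lookup m i) * Poly_Mapping.lookup h m)"
  let ?K = "Poly_Mapping.keys f \<union> Poly_Mapping.keys g"
  have *: "partial i h = sum (?t h) ?K" if "Poly_Mapping.keys h \<subseteq> ?K" for h
    unfolding partial_def using that
    by (intro sum.mono_neutral_left) (auto simp: in_keys_iff)
  show ?thesis
    by (simp add: * Poly_Mapping.keys_add sum.distrib [symmetric] lookup_add distrib_left single_add)
qed

lemma mpoly_induct:
  fixes f :: "('k::field, 'n::finite) mpoly"
  assumes "\<And>m c. P (Poly_Mapping.single m c)" and "\<And>f g. P f \<Longrightarrow> P g \<Longrightarrow> P (f + g)"
  shows "P f"
proof -
  have *: "P (\<Sum>m\<in>K. Poly_Mapping.single m (Poly_Mapping.lookup f m))" if "finite K" for K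
    using that by (induction K) (use assms assms(1) [of 0 0] in auto)
  have "(\<Sum>m\<in>Poly_Mapping.keys f. Poly_Mapping.single m (Poly_Mapping.lookup f m)) = f"
    by (rule poly_mapping_eqI)
      (auto simp: lookup_sum lookup_single when_def in_keys_iff)
  with * [OF finite_keys [of f]] show ?thesis by simp
qed

lemma partial_mult:
  fixes f g :: "('k::field, 'n::finite) mpoly"
  shows "partial i (f * g) = f * partial i g + g * partial i f"
proof (induction f rule: mpoly_induct)
  case (1 m c)
  show ?case
  proof (induction g rule: mpoly_induct)
    case (1 n d)
    have shift: "k + (l - Poly_Mapping.single i 1) = k + l - Poly_Mapping.single i 1"
      if "Poly_Mapping.lookup l i \<noteq> 0" for k l :: "'n \<Rightarrow>\<^sub>0 nat"
      using that by (intro poly_mapping_eqI) (auto simp: lookup_add lookup_minus lookup_single when_def)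
    have *: "Poly_Mapping.single (m + n - Poly_Mapping.single i 1) (of_nat (Poly_Mapping.lookup n i) * (c * d)) =
        Poly_Mapping.single m c * partial i (Poly_Mapping.single n d)"
      using shift [where k = m and l = n]
      by (cases "Poly_Mapping.lookup n i = 0") (simp_all add: partial_single mult_single mult.left_commute)
    have **: "Poly_Mapping.single (m + n - Poly_Mapping.single i 1) (of_nat (Poly_Mapping.lookup m i) * (c * d)) =
        Poly_Mapping.single n d * partial i (Poly_Mapping.single m c)"
      using shift [where k = n and l = m]
      by (cases "Poly_Mapping.lookup m i = 0")
        (simp_all add: partial_single mult_single mult.left_commute mult.commute [of c d] add.commute [of m n])
    show ?case
      unfolding * [symmetric] ** [symmetric]
      by (simp add: mult_single partial_single lookup_add distrib_right single_add add.commute)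
  qed (simp add: partial_add algebra_simps)
qed (simp add: partial_add algebra_simps)

lemma partial_const: "partial i (const_poly k) = 0"
  by (simp add: const_poly_def partial_single)

lemma partial_var: "partial i (var_poly j) = (if i = j then 1 else 0)"
  by (simp add: var_poly_def partial_single lookup_single when_def)

lemma derivations_SV_cong:
  assumes \<theta>: "\<theta> \<in> derivations SV const_poly" and \<eta>: "\<eta> \<in> derivations SV const_poly"
    and v: "\<And>i. \<theta> (var_poly i) = \<eta> (var_poly i)"
  shows "\<theta> f = \<eta> f"
proof (induction f rule: mpoly_induct)
  case (1 m c)
  show ?case
  proof (induction "\<Sum>i\<in>UNIV. Poly_Mapping.lookup m i" arbitrary: m)
    case 0
    then have "m = 0" by (intro poly_mapping_eqI) simp
    then have "Poly_Mapping.single m c = const_poly c" by (simp add: const_poly_def)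
    then show ?case using \<theta> \<eta> by (simp add: derivations_SV_iff)
  next
    case (Suc n)
    then have "\<exists>i. Poly_Mapping.lookup m i \<noteq> 0"
      by (metis (no_types, lifting) nat.distinct(1) sum.neutral)
    then obtain i where i: "Poly_Mapping.lookup m i \<noteq> 0" by blast
    define m' where "m' = m - Poly_Mapping.single i 1"
    have m: "m = Poly_Mapping.single i 1 + m'"
      using i unfolding m'_def
      by (intro poly_mapping_eqI) (auto simp: lookup_add lookup_minus lookup_single when_def)
    have "(\<Sum>j\<in>UNIV. Poly_Mapping.lookup m j) = 1 + (\<Sum>j\<in>UNIV. Poly_Mapping.lookup m' j)"
      by (simp add: m lookup_add sum.distrib lookup_single when_def)
    with Suc have "\<theta> (Poly_Mapping.single m' c) = \<eta> (Poly_Mapping.single m' c)" by simp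
    moreover have "Poly_Mapping.single m c = var_poly i * Poly_Mapping.single m' c"
      by (simp add: var_poly_def mult_single m)
    ultimately show ?case using \<theta> \<eta> v by (simp add: derivations_SV_iff)
  qed
next
  case (2 f g)
  then show ?case using \<theta> \<eta> by (simp add: derivations_SV_iff)
qed

lemma derivations_SV_eq:
  "(derivations SV const_poly :: (('k::field, 'n::finite) mpoly \<Rightarrow> _) set) =
     range (\<lambda>g f. \<Sum>i\<in>UNIV. g i * partial i f)"
proof -
  have *: "(\<lambda>f. \<Sum>i\<in>UNIV. g i * partial i f) \<in> derivations SV const_poly"
    for g :: "'n \<Rightarrow> ('k, 'n) mpoly"
    by (simp add: derivations_SV_iff partial_add partial_mult partial_const
        distrib_left sum.distrib sum_distrib_left mult.left_commute)
  have "\<theta> = (\<lambda>f. \<Sum>i\<in>UNIV. \<theta> (var_poly i) * partial i f)"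
    if "\<theta> \<in> derivations SV const_poly" for \<theta> :: "('k, 'n) mpoly \<Rightarrow> ('k, 'n) mpoly"
    by (rule ext, rule derivations_SV_cong [OF that *]) (simp add: partial_var if_distrib cong: if_cong)
  then have "\<theta> \<in> range (\<lambda>g f. \<Sum>i\<in>UNIV. g i * partial i f)"
    if "\<theta> \<in> derivations SV const_poly" for \<theta> :: "('k, 'n) mpoly \<Rightarrow> ('k, 'n) mpoly"
    using that by (intro range_eqI [where x = "\<lambda>i. \<theta> (var_poly i)"])
  then show ?thesis
    by (intro equalityI subsetI) (auto intro: *)
qed

lemma inj_derivation_coeffs:
  "inj (\<lambda>(g :: 'n \<Rightarrow> ('k::field, 'n::finite) mpoly) f. \<Sum>i\<in>UNIV. g i * partial i f)"
proof (rule injI)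
  fix g h :: "'n \<Rightarrow> ('k, 'n) mpoly"
  assume eq: "(\<lambda>f. \<Sum>i\<in>UNIV. g i * partial i f) = (\<lambda>f. \<Sum>i\<in>UNIV. h i * partial i f)"
  show "g = h"
  proof
    fix j show "g j = h j"
      using fun_cong [OF eq, of "var_poly j"] by (simp add: partial_var if_distrib cong: if_cong)
  qed
qed

end

theory Submission
  imports Defs
begin

text \<open>
  Write \<open>a\<close> for the form of \<open>H\<close>, \<open>A' = A - {H}\<close>, and let \<open>\<Theta>\<close> be a logarithmic derivation of the
  restriction.  It lifts to a derivation \<open>\<theta>\<close> of the polynomial ring \<open>S\<close> with \<open>\<theta>(a) \<in> (a)\<close>, and the
  task is to correct \<open>\<theta>\<close> by a multiple of \<open>a\<close> so that it becomes logarithmic along all of \<open>A\<close>.  Call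
  \<open>f\<close> good if \<open>f\<theta>\<close> can be corrected in this way; the claim is that \<open>1\<close> is good.

  The product of the forms of all \<open>L \<in> A'\<close> is good for trivial reasons, so it is enough to cancel
  its factors \<open>b = \<alpha>\<^sub>L\<close> one at a time.  Two facts make this possible.

  First, near the generic point of \<open>X = H \<inter> L\<close> the arrangement has rank two, and there the lift
  can be written down: every other hyperplane through \<open>X\<close> has a form in the span of \<open>a\<close> and \<open>b\<close>,
  and \<open>\<theta>\<close> can be changed modulo \<open>a\<close> to multiply both \<open>a\<close> and \<open>b\<close>, hence the whole span, by one
  polynomial \<open>q\<close> (\<open>rank2_lift\<close>).  Multiplying by the forms of the hyperplanes not containing \<open>X\<close>
  shows that some \<open>g\<close> outside the prime ideal \<open>(a, b)\<close> is good (\<open>local_lift\<close>).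

  Second, if \<open>bf\<close> and \<open>g\<close> are good, with corrected derivations \<open>\<zeta>\<close> and \<open>\<eta>\<close>, then
  \<open>g\<zeta> - bf\<eta> = a\<kappa>\<close> for some \<open>\<kappa> \<in> D(A')\<close>.  Since \<open>D(A')\<close> has projective dimension zero, it is a
  retract of a free module, so the congruence \<open>g\<zeta> \<equiv> 0\<close> modulo \<open>(a, b)\<close> can be read off coordinate
  by coordinate; as \<open>(a, b)\<close> is prime and does not contain \<open>g\<close>, this gives \<open>\<zeta> = b\<xi> + a\<mu>\<close> with
  \<open>\<xi>, \<mu> \<in> D(A')\<close> (\<open>proj_dim_zero_divisible\<close>).  Cancelling \<open>b\<close> modulo the prime \<open>a\<close> shows that \<open>\<xi>\<close>
  corrects \<open>f\<theta>\<close>, so \<open>f\<close> is good (\<open>cancel_factor\<close>).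

  In other words, this is a depth-two argument on \<open>H\<close>, and surjectivity has to be checked locally
  only at the generic points of the hyperplanes of the restriction.
\<close>

section \<open>Modules of projective dimension zero\<close>

text \<open>A resolution of length zero is a single projective module \<open>P 0\<close> with an augmentation onto \<open>M\<close>
  whose kernel is the image of the zero module, that is, an isomorphism; the splitting of \<open>P 0\<close> off
  a free module is transported along it.  The basis \<open>B\<close> stays in the element type of \<open>P 0\<close>, which
  is why the conclusion is a retraction and not \<open>projective_module R M\<close>.\<close>

lemma proj_dim_zero_retract:
  fixes R :: "('r, 'c) ring_scheme" and M :: "('r, 'm, 'd) module_scheme"
  assumes M: "Module.module R M" and pd: "proj_dim R M = 0"
  shows "\<exists>(B :: (('m \<times> 'r) list \<Rightarrow> 'r) set) \<iota> \<pi>. \<iota> \<in> mod_hom R M (free_module R B) \<and>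
    \<pi> \<in> mod_hom R (free_module R B) M \<and> (\<forall>x\<in>carrier M. \<pi> (\<iota> x) = x)"
proof -
  let ?S = "{n :: nat. \<exists>(P :: nat \<Rightarrow> ('r, ('m \<times> 'r) list \<Rightarrow> 'r) module) d e.
      projective_resolution R M P d e \<and> (\<forall>i>n. carrier (P i) = {\<zero>\<^bsub>P i\<^esub>})}"
  have 0: "Inf (enat ` ?S) = 0" using pd by (simp add: proj_dim_def)
  have ne: "enat ` ?S \<noteq> {}" using 0 by (auto simp: Inf_enat_def split: if_splits)
  have "Inf (enat ` ?S) \<in> enat ` ?S"
    using ne unfolding Inf_enat_def by (metis (mono_tags, lifting) LeastI_ex ex_in_conv)
  then have "0 \<in> ?S" unfolding 0 by (auto simp: zero_enat_def)
  then obtain P :: "nat \<Rightarrow> ('r, ('m \<times> 'r) list \<Rightarrow> 'r) module" and d e where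
    res: "projective_resolution R M P d e" and triv: "\<And>i. i > 0 \<Longrightarrow> carrier (P i) = {\<zero>\<^bsub>P i\<^esub>}"
    by blast
  have proj: "projective_module R (P 0)" and e: "e \<in> mod_hom R (P 0) M"
    and surj: "e ` carrier (P 0) = carrier M"
    and ker: "d 0 ` carrier (P 1) = {x \<in> carrier (P 0). e x = \<zero>\<^bsub>M\<^esub>}"
    using res by (auto simp: projective_resolution_def)
  interpret M: Module.module R M by fact
  interpret P: Module.module R "P 0" using proj by (simp add: projective_module_def)
  have e_mem: "e x \<in> carrier M" if "x \<in> carrier (P 0)" for x
    using e that by (auto simp: mod_hom_def)
  have e_add: "e (x \<oplus>\<^bsub>P 0\<^esub> y) = e x \<oplus>\<^bsub>M\<^esub> e y" if "x \<in> carrier (P 0)" "y \<in> carrier (P 0)" for x y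
    using e that by (auto simp: mod_hom_def)
  have e_smult: "e (a \<odot>\<^bsub>P 0\<^esub> x) = a \<odot>\<^bsub>M\<^esub> e x" if "a \<in> carrier R" "x \<in> carrier (P 0)" for a x
    using e that by (auto simp: mod_hom_def)
  have e_zero: "x = \<zero>\<^bsub>P 0\<^esub>" if x: "x \<in> carrier (P 0)" "e x = \<zero>\<^bsub>M\<^esub>" for x
  proof -
    have "e \<zero>\<^bsub>P 0\<^esub> = e \<zero>\<^bsub>P 0\<^esub> \<oplus>\<^bsub>M\<^esub> e \<zero>\<^bsub>P 0\<^esub>"
      using e_add[of "\<zero>\<^bsub>P 0\<^esub>" "\<zero>\<^bsub>P 0\<^esub>"] by simp
    then have "e \<zero>\<^bsub>P 0\<^esub> = \<zero>\<^bsub>M\<^esub>"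
      using e_mem[of "\<zero>\<^bsub>P 0\<^esub>"] by (metis M.add.r_cancel_one P.zero_closed)
    then have "\<zero>\<^bsub>P 0\<^esub> \<in> d 0 ` carrier (P 1)" "x \<in> d 0 ` carrier (P 1)"
      unfolding ker using x by auto
    then show ?thesis using triv[of 1] by simp
  qed
  have inj: "inj_on e (carrier (P 0))"
  proof (rule inj_onI)
    fix x y assume xy: "x \<in> carrier (P 0)" "y \<in> carrier (P 0)" "e x = e y"
    let ?z = "x \<oplus>\<^bsub>P 0\<^esub> \<ominus>\<^bsub>P 0\<^esub> y"
    have z: "?z \<in> carrier (P 0)" and x: "?z \<oplus>\<^bsub>P 0\<^esub> y = x"
      using xy by (simp_all add: P.add.m_assoc P.l_neg)
    have "e ?z \<oplus>\<^bsub>M\<^esub> e y = e y" using e_add[OF z xy(2)] x xy(3) by simp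
    then have "e ?z = \<zero>\<^bsub>M\<^esub>" using M.add.r_cancel_one[OF e_mem[OF xy(2)] e_mem[OF z]] by simp
    then have "?z = \<zero>\<^bsub>P 0\<^esub>" using e_zero z by blast
    with x xy(2) show "x = y" by simp
  qed
  obtain B :: "(('m \<times> 'r) list \<Rightarrow> 'r) set" and \<iota> \<pi> where
    i: "\<iota> \<in> mod_hom R (P 0) (free_module R B)" and p: "\<pi> \<in> mod_hom R (free_module R B) (P 0)"
    and pi: "\<And>x. x \<in> carrier (P 0) \<Longrightarrow> \<pi> (\<iota> x) = x"
    using proj by (auto simp: projective_module_def)
  define e' where "e' = inv_into (carrier (P 0)) e"
  have e'_mem: "e' y \<in> carrier (P 0)" and ee': "e (e' y) = y" if "y \<in> carrier M" for y
    using that surj by (auto simp: e'_def inv_into_into f_inv_into_f)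
  have e'e: "e' (e x) = x" if "x \<in> carrier (P 0)" for x
    using that inj by (simp add: e'_def)
  have e'_add: "e' (x \<oplus>\<^bsub>M\<^esub> y) = e' x \<oplus>\<^bsub>P 0\<^esub> e' y" if "x \<in> carrier M" "y \<in> carrier M" for x y
    using e'e[of "e' x \<oplus>\<^bsub>P 0\<^esub> e' y"] that by (simp add: e'_mem e_add ee')
  have e'_smult: "e' (a \<odot>\<^bsub>M\<^esub> x) = a \<odot>\<^bsub>P 0\<^esub> e' x" if "a \<in> carrier R" "x \<in> carrier M" for a x
    using e'e[of "a \<odot>\<^bsub>P 0\<^esub> e' x"] that by (simp add: e'_mem e_smult ee')
  show ?thesis
  proof (intro exI conjI ballI)
    show "\<iota> \<circ> e' \<in> mod_hom R M (free_module R B)"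
      using i by (auto simp: mod_hom_def e'_mem e'_add e'_smult)
    show "e \<circ> \<pi> \<in> mod_hom R (free_module R B) M"
      using p unfolding mod_hom_def
      by (auto simp: Pi_iff e_mem e_add e_smult)
    show "(e \<circ> \<pi>) ((\<iota> \<circ> e') x) = x" if "x \<in> carrier M" for x
      using that by (simp add: e'_mem pi ee')
  qed
qed

text \<open>If \<open>g\<close> is cancellable modulo the ideal \<open>(a, b)\<close> of the ring, then it is cancellable modulo
  \<open>(a, b)M\<close>: this is true in each coordinate of a free module, and the retraction \<open>\<pi>\<close> carries it over
  to \<open>M\<close>.\<close>

lemma retract_of_free_divisible:
  fixes R :: "('r, 'c) ring_scheme" and M :: "('r, 'm, 'd) module_scheme" and B :: "'b set"
  assumes M: "Module.module R M"
    and retract: "\<iota> \<in> mod_hom R M (free_module R B) \<and> \<pi> \<in> mod_hom R (free_module R B) M \<and>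
      (\<forall>x\<in>carrier M. \<pi> (\<iota> x) = x)"
    and R: "g \<in> carrier R" "b \<in> carrier R" "a \<in> carrier R"
    and xyz: "x \<in> carrier M" "y \<in> carrier M" "z \<in> carrier M"
    and eq: "g \<odot>\<^bsub>M\<^esub> x = b \<odot>\<^bsub>M\<^esub> y \<oplus>\<^bsub>M\<^esub> a \<odot>\<^bsub>M\<^esub> z"
    and divide: "\<And>c d e. c \<in> carrier R \<Longrightarrow> d \<in> carrier R \<Longrightarrow> e \<in> carrier R \<Longrightarrow>
      g \<otimes>\<^bsub>R\<^esub> c = b \<otimes>\<^bsub>R\<^esub> d \<oplus>\<^bsub>R\<^esub> a \<otimes>\<^bsub>R\<^esub> e \<Longrightarrow>
      \<exists>d'\<in>carrier R. \<exists>e'\<in>carrier R. c = b \<otimes>\<^bsub>R\<^esub> d' \<oplus>\<^bsub>R\<^esub> a \<otimes>\<^bsub>R\<^esub> e'"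
  shows "\<exists>y'\<in>carrier M. \<exists>z'\<in>carrier M. x = b \<odot>\<^bsub>M\<^esub> y' \<oplus>\<^bsub>M\<^esub> a \<odot>\<^bsub>M\<^esub> z'"
proof -
  interpret M: Module.module R M by fact
  have i: "\<iota> \<in> mod_hom R M (free_module R B)" and p: "\<pi> \<in> mod_hom R (free_module R B) M"
    and pi: "\<pi> (\<iota> x) = x"
    using retract xyz(1) by blast+
  let ?F = "free_module R B"
  have F: "v \<in> carrier ?F \<longleftrightarrow> (\<forall>j. v j \<in> carrier R) \<and> (\<forall>j. j \<notin> B \<longrightarrow> v j = \<zero>\<^bsub>R\<^esub>) \<and>
      finite {j. v j \<noteq> \<zero>\<^bsub>R\<^esub>}" for v
    by (simp add: free_module_def)
  have F_ops: "v \<oplus>\<^bsub>?F\<^esub> w = (\<lambda>j. v j \<oplus>\<^bsub>R\<^esub> w j)" "c \<odot>\<^bsub>?F\<^esub> v = (\<lambda>j. c \<otimes>\<^bsub>R\<^esub> v j)" for v w c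
    by (simp_all add: free_module_def)
  have i_mem: "\<iota> v \<in> carrier ?F" if "v \<in> carrier M" for v
    using i that by (auto simp: mod_hom_def)
  have "\<iota> (g \<odot>\<^bsub>M\<^esub> x) = \<iota> (b \<odot>\<^bsub>M\<^esub> y \<oplus>\<^bsub>M\<^esub> a \<odot>\<^bsub>M\<^esub> z)" by (simp add: eq)
  then have "(\<lambda>j. g \<otimes>\<^bsub>R\<^esub> \<iota> x j) = (\<lambda>j. b \<otimes>\<^bsub>R\<^esub> \<iota> y j \<oplus>\<^bsub>R\<^esub> a \<otimes>\<^bsub>R\<^esub> \<iota> z j)"
    using i R xyz by (simp add: mod_hom_def F_ops)
  then have eqj: "g \<otimes>\<^bsub>R\<^esub> \<iota> x j = b \<otimes>\<^bsub>R\<^esub> \<iota> y j \<oplus>\<^bsub>R\<^esub> a \<otimes>\<^bsub>R\<^esub> \<iota> z j" for j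
    by (rule fun_cong)
  \<comment> \<open>Where the coordinate of \<open>\<iota> x\<close> is zero the coefficients are chosen to be zero, so that they
    again form vectors of finite support in \<open>B\<close>.\<close>
  have "\<exists>de. fst de \<in> carrier R \<and> snd de \<in> carrier R \<and> \<iota> x j = b \<otimes>\<^bsub>R\<^esub> fst de \<oplus>\<^bsub>R\<^esub> a \<otimes>\<^bsub>R\<^esub> snd de \<and>
      (\<iota> x j = \<zero>\<^bsub>R\<^esub> \<longrightarrow> de = (\<zero>\<^bsub>R\<^esub>, \<zero>\<^bsub>R\<^esub>))" for j
  proof (cases "\<iota> x j = \<zero>\<^bsub>R\<^esub>")
    case True
    then show ?thesis using R by simp
  next
    case False
    have "\<iota> x j \<in> carrier R" "\<iota> y j \<in> carrier R" "\<iota> z j \<in> carrier R"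
      using i_mem xyz F by blast+
    from divide[OF this eqj] False show ?thesis by auto
  qed
  then obtain de where de: "\<And>j. fst (de j) \<in> carrier R \<and> snd (de j) \<in> carrier R \<and>
      \<iota> x j = b \<otimes>\<^bsub>R\<^esub> fst (de j) \<oplus>\<^bsub>R\<^esub> a \<otimes>\<^bsub>R\<^esub> snd (de j) \<and>
      (\<iota> x j = \<zero>\<^bsub>R\<^esub> \<longrightarrow> de j = (\<zero>\<^bsub>R\<^esub>, \<zero>\<^bsub>R\<^esub>))" by metis
  have de_mem: "fst (de j) \<in> carrier R" "snd (de j) \<in> carrier R" for j
    using de by blast+
  have de_0: "de j = (\<zero>\<^bsub>R\<^esub>, \<zero>\<^bsub>R\<^esub>)" if "\<iota> x j = \<zero>\<^bsub>R\<^esub>" for j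
    using de that by blast
  have x: "\<forall>j. j \<notin> B \<longrightarrow> \<iota> x j = \<zero>\<^bsub>R\<^esub>" "finite {j. \<iota> x j \<noteq> \<zero>\<^bsub>R\<^esub>}"
    using i_mem[OF xyz(1)] F by blast+
  have "{j. fst (de j) \<noteq> \<zero>\<^bsub>R\<^esub>} \<subseteq> {j. \<iota> x j \<noteq> \<zero>\<^bsub>R\<^esub>}" "{j. snd (de j) \<noteq> \<zero>\<^bsub>R\<^esub>} \<subseteq> {j. \<iota> x j \<noteq> \<zero>\<^bsub>R\<^esub>}"
    using de_0 by fastforce+
  then have fin: "finite {j. fst (de j) \<noteq> \<zero>\<^bsub>R\<^esub>}" "finite {j. snd (de j) \<noteq> \<zero>\<^bsub>R\<^esub>}"
    using x(2) finite_subset by blast+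
  have "de j = (\<zero>\<^bsub>R\<^esub>, \<zero>\<^bsub>R\<^esub>)" if "j \<notin> B" for j
    using de_0 x(1) that by blast
  then have dF: "fst \<circ> de \<in> carrier ?F" and eF: "snd \<circ> de \<in> carrier ?F"
    unfolding F using de_mem fin by simp_all
  have sF: "c \<odot>\<^bsub>?F\<^esub> v \<in> carrier ?F" if "c \<in> carrier R" "v \<in> carrier ?F" for c v
  proof -
    have "{j. c \<otimes>\<^bsub>R\<^esub> v j \<noteq> \<zero>\<^bsub>R\<^esub>} \<subseteq> {j. v j \<noteq> \<zero>\<^bsub>R\<^esub>}" using that by auto
    then show ?thesis using that unfolding F F_ops by (auto intro: finite_subset)
  qed
  have "\<iota> x = b \<odot>\<^bsub>?F\<^esub> (fst \<circ> de) \<oplus>\<^bsub>?F\<^esub> a \<odot>\<^bsub>?F\<^esub> (snd \<circ> de)"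
    unfolding F_ops comp_apply using de by blast
  then have "\<pi> (\<iota> x) = b \<odot>\<^bsub>M\<^esub> \<pi> (fst \<circ> de) \<oplus>\<^bsub>M\<^esub> a \<odot>\<^bsub>M\<^esub> \<pi> (snd \<circ> de)"
    using p R dF eF sF[OF R(2) dF] sF[OF R(3) eF] by (simp add: mod_hom_def)
  moreover have "\<pi> (fst \<circ> de) \<in> carrier M" "\<pi> (snd \<circ> de) \<in> carrier M"
    using p dF eF by (auto simp: mod_hom_def)
  ultimately show ?thesis using pi by metis
qed

lemma proj_dim_zero_divisible:
  fixes R :: "('r, 'c) ring_scheme" and M :: "('r, 'm, 'd) module_scheme"
  assumes M: "Module.module R M" and pd: "proj_dim R M = 0"
    and R: "g \<in> carrier R" "b \<in> carrier R" "a \<in> carrier R"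
    and xyz: "x \<in> carrier M" "y \<in> carrier M" "z \<in> carrier M"
    and eq: "g \<odot>\<^bsub>M\<^esub> x = b \<odot>\<^bsub>M\<^esub> y \<oplus>\<^bsub>M\<^esub> a \<odot>\<^bsub>M\<^esub> z"
    and divide: "\<And>c d e. c \<in> carrier R \<Longrightarrow> d \<in> carrier R \<Longrightarrow> e \<in> carrier R \<Longrightarrow>
      g \<otimes>\<^bsub>R\<^esub> c = b \<otimes>\<^bsub>R\<^esub> d \<oplus>\<^bsub>R\<^esub> a \<otimes>\<^bsub>R\<^esub> e \<Longrightarrow>
      \<exists>d'\<in>carrier R. \<exists>e'\<in>carrier R. c = b \<otimes>\<^bsub>R\<^esub> d' \<oplus>\<^bsub>R\<^esub> a \<otimes>\<^bsub>R\<^esub> e'"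
  shows "\<exists>y'\<in>carrier M. \<exists>z'\<in>carrier M. x = b \<odot>\<^bsub>M\<^esub> y' \<oplus>\<^bsub>M\<^esub> a \<odot>\<^bsub>M\<^esub> z'"
  using proj_dim_zero_retract[OF M pd]
  by (elim exE) (rule retract_of_free_divisible[OF M _ R xyz eq divide])

section \<open>Polynomials\<close>

lemma const_poly_0 [simp]: "const_poly 0 = 0"
  by (simp add: const_poly_def)

lemma const_poly_1 [simp]: "const_poly 1 = 1"
  by (simp add: const_poly_def)

lemma const_poly_add: "const_poly (c + d) = const_poly c + const_poly d"
  by (simp add: const_poly_def single_add)

lemma const_poly_mult: "const_poly (c * d) = const_poly c * const_poly d"
  by (simp add: const_poly_def mult_single)

lemma const_poly_uminus: "const_poly (- c) = - const_poly c"
  by (simp add: const_poly_def single_uminus)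

lemma const_poly_sum: "const_poly (sum h I) = (\<Sum>i\<in>I. const_poly (h i))"
  by (induction I rule: infinite_finite_induct) (simp_all add: const_poly_add)

lemma const_poly_eq_iff: "const_poly c = const_poly d \<longleftrightarrow> c = d"
  by (metis const_poly_def lookup_single_eq)

lemma const_poly_inverse:
  assumes "c \<noteq> 0" shows "const_poly (inverse c) * (const_poly c * f) = f"
  using assms by (simp add: mult.assoc [symmetric] const_poly_mult [symmetric])

lemma mpoly_algebra_induct:
  fixes f :: "('k::field, 'n::finite) mpoly"
  assumes const: "\<And>c. P (const_poly c)" and var: "\<And>i. P (var_poly i)"
    and add: "\<And>f g. P f \<Longrightarrow> P g \<Longrightarrow> P (f + g)" and mult: "\<And>f g. P f \<Longrightarrow> P g \<Longrightarrow> P (f * g)"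
  shows "P f"
proof (induction f rule: mpoly_induct)
  case (1 m c)
  show ?case
  proof (induction "\<Sum>i\<in>UNIV. Poly_Mapping.lookup m i" arbitrary: m)
    case 0
    then have "m = 0" by (intro poly_mapping_eqI) simp
    then show ?case using const[of c] by (simp add: const_poly_def)
  next
    case (Suc n)
    then obtain i where i: "Poly_Mapping.lookup m i \<noteq> 0"
      by (metis (no_types, lifting) nat.distinct(1) sum.neutral)
    define m' where "m' = m - Poly_Mapping.single i 1"
    have m: "m = Poly_Mapping.single i 1 + m'"
      using i unfolding m'_def
      by (intro poly_mapping_eqI) (auto simp: lookup_add lookup_minus lookup_single when_def)
    have "(\<Sum>j\<in>UNIV. Poly_Mapping.lookup m j) = 1 + (\<Sum>j\<in>UNIV. Poly_Mapping.lookup m' j)"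
      by (simp add: m lookup_add sum.distrib lookup_single when_def)
    with Suc have "P (Poly_Mapping.single m' c)" by simp
    moreover have "Poly_Mapping.single m c = var_poly i * Poly_Mapping.single m' c"
      by (simp add: var_poly_def mult_single m)
    ultimately show ?case using mult var by simp
  qed
next
  case (2 f g)
  then show ?case by (rule add)
qed

text \<open>The exponent vectors carry no linear order, since the index type need not have one.  Enumerating
  the indices embeds them additively into \<open>nat \<Rightarrow>\<^sub>0 nat\<close>, which is linearly ordered, and then the
  leading coefficients of \<open>f\<close> and \<open>g\<close> multiply.\<close>

lemma mpoly_no_zero_divisors:
  fixes f g :: "('k::field, 'n::finite) mpoly"
  assumes "f \<noteq> 0" "g \<noteq> 0"
  shows "f * g \<noteq> 0"
proof -
  define \<nu> :: "('n \<Rightarrow>\<^sub>0 nat) \<Rightarrow> (nat \<Rightarrow>\<^sub>0 nat)"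
    where "\<nu> m = (\<Sum>i\<in>UNIV. Poly_Mapping.single (to_nat i) (Poly_Mapping.lookup m i))" for m
  have \<nu>_add: "\<nu> (m + n) = \<nu> m + \<nu> n" for m n
    by (simp add: \<nu>_def lookup_add single_add sum.distrib)
  have "Poly_Mapping.lookup (\<nu> m) (to_nat i) = Poly_Mapping.lookup m i" for m i
    by (simp add: \<nu>_def lookup_sum lookup_single when_def)
  then have \<nu>_inj: "\<nu> m = \<nu> n \<Longrightarrow> m = n" for m n
    by (metis poly_mapping_eqI)
  have top: "\<exists>m\<in>Poly_Mapping.keys h. \<forall>n\<in>Poly_Mapping.keys h. \<nu> n \<le> \<nu> m"
    if "h \<noteq> 0" for h :: "('k, 'n) mpoly"
  proof -
    have "Max (\<nu> ` Poly_Mapping.keys h) \<in> \<nu> ` Poly_Mapping.keys h"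
      using that by (intro Max_in) auto
    then obtain m where "m \<in> Poly_Mapping.keys h" "\<nu> m = Max (\<nu> ` Poly_Mapping.keys h)" by auto
    then show ?thesis by (auto intro!: bexI[of _ m])
  qed
  obtain m where m: "m \<in> Poly_Mapping.keys f" "\<And>a. a \<in> Poly_Mapping.keys f \<Longrightarrow> \<nu> a \<le> \<nu> m"
    using top[OF assms(1)] by blast
  obtain n where n: "n \<in> Poly_Mapping.keys g" "\<And>b. b \<in> Poly_Mapping.keys g \<Longrightarrow> \<nu> b \<le> \<nu> n"
    using top[OF assms(2)] by blast
  have only: "a + b = m + n \<longleftrightarrow> a = m \<and> b = n"
    if "a \<in> Poly_Mapping.keys f" "b \<in> Poly_Mapping.keys g" for a b
  proof
    assume "a + b = m + n"
    then have "\<nu> a + \<nu> b = \<nu> m + \<nu> n" by (metis \<nu>_add)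
    moreover have "\<nu> a \<le> \<nu> m" "\<nu> b \<le> \<nu> n" using m n that by auto
    ultimately have "\<nu> a = \<nu> m \<and> \<nu> b = \<nu> n"
      by (metis add_le_cancel_left add_le_cancel_right add_mono antisym order.refl add_left_cancel add_right_cancel)
    then show "a = m \<and> b = n" by (auto dest: \<nu>_inj)
  qed simp
  have expand: "(\<Sum>a\<in>Poly_Mapping.keys h. Poly_Mapping.single a (Poly_Mapping.lookup h a)) = h" for h :: "('k, 'n) mpoly"
    by (rule poly_mapping_eqI) (auto simp: lookup_sum lookup_single when_def in_keys_iff)
  have "f * g = (\<Sum>a\<in>Poly_Mapping.keys f. \<Sum>b\<in>Poly_Mapping.keys g.
      Poly_Mapping.single (a + b) (Poly_Mapping.lookup f a * Poly_Mapping.lookup g b))"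
    by (subst expand[of f, symmetric], subst expand[of g, symmetric])
      (simp add: sum_product mult_single)
  then have "Poly_Mapping.lookup (f * g) (m + n) = (\<Sum>a\<in>Poly_Mapping.keys f. \<Sum>b\<in>Poly_Mapping.keys g.
      if a = m \<and> b = n then Poly_Mapping.lookup f a * Poly_Mapping.lookup g b else 0)"
    using only by (simp add: lookup_sum lookup_single when_def)
  also have "\<dots> = (\<Sum>a\<in>Poly_Mapping.keys f. if a = m then \<Sum>b\<in>Poly_Mapping.keys g.
      if b = n then Poly_Mapping.lookup f a * Poly_Mapping.lookup g b else 0 else 0)"
    by (intro sum.cong) auto
  also have "\<dots> = Poly_Mapping.lookup f m * Poly_Mapping.lookup g n"
    using m(1) n(1) by (simp add: sum.delta)
  also have "\<dots> \<noteq> 0" using m(1) n(1) by (simp add: in_keys_iff)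
  finally show ?thesis by auto
qed

text \<open>The algebra endomorphism that sends the \<open>i\<close>-th variable to \<open>s i\<close>.\<close>

definition subst :: "('n \<Rightarrow> ('k, 'n) mpoly) \<Rightarrow> ('k::field, 'n::finite) mpoly \<Rightarrow> ('k, 'n) mpoly"
  where "subst s f = (\<Sum>m\<in>Poly_Mapping.keys f.
    const_poly (Poly_Mapping.lookup f m) * (\<Prod>i\<in>UNIV. s i ^ Poly_Mapping.lookup m i))"

lemma subst_single:
  "subst s (Poly_Mapping.single m c) = const_poly c * (\<Prod>i\<in>UNIV. s i ^ Poly_Mapping.lookup m i)"
  by (cases "c = 0") (simp_all add: subst_def)

lemma subst_add: "subst s (f + g) = subst s f + subst s g"
proof -
  let ?t = "\<lambda>h m. const_poly (Poly_Mapping.lookup h m) * (\<Prod>i\<in>UNIV. s i ^ Poly_Mapping.lookup m i)"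
  let ?K = "Poly_Mapping.keys f \<union> Poly_Mapping.keys g"
  have *: "subst s h = sum (?t h) ?K" if "Poly_Mapping.keys h \<subseteq> ?K" for h
    unfolding subst_def using that
    by (intro sum.mono_neutral_left) (auto simp: in_keys_iff)
  show ?thesis
    by (simp add: * Poly_Mapping.keys_add sum.distrib [symmetric] lookup_add const_poly_add distrib_right)
qed

lemma subst_mult: "subst s (f * g) = subst s f * subst s g"
proof (induction f rule: mpoly_induct)
  case (1 m c)
  show ?case
    by (induction g rule: mpoly_induct)
      (simp_all add: mult_single subst_single lookup_add power_add prod.distrib const_poly_mult
        subst_add algebra_simps)
qed (simp add: subst_add algebra_simps)

lemma subst_const: "subst s (const_poly c) = const_poly c"
  unfolding const_poly_def by (subst subst_single) (simp add: const_poly_def)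

lemma subst_one: "subst s 1 = 1"
  using subst_const[of s 1] by simp

lemma subst_var: "subst s (var_poly j) = s j"
proof -
  have "(\<Prod>i\<in>UNIV. s i ^ Poly_Mapping.lookup (Poly_Mapping.single j 1) i) =
      (\<Prod>i\<in>UNIV. if i = j then s i else 1)"
    by (intro prod.cong) (auto simp: lookup_single when_def)
  then show ?thesis by (simp add: var_poly_def subst_single)
qed

lemma subst_sum: "subst s (sum h I) = (\<Sum>i\<in>I. subst s (h i))"
proof -
  have "subst s 0 = 0" by (simp add: subst_def)
  then show ?thesis
    by (induction I rule: infinite_finite_induct) (simp_all add: subst_add)
qed

text \<open>The ideal \<open>(a, b)\<close>.  It is given by its elements because it is used through equations only;
  with \<open>b = 0\<close> it is the principal ideal of \<open>a\<close>.\<close>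

definition ideal2 :: "'r::comm_ring_1 \<Rightarrow> 'r \<Rightarrow> 'r set"
  where "ideal2 a b = {a * x + b * y | x y. True}"

lemma ideal2_iff: "f \<in> ideal2 a b \<longleftrightarrow> (\<exists>x y. f = a * x + b * y)"
  by (simp add: ideal2_def)

lemma ideal2_add:
  assumes "f \<in> ideal2 a b" "g \<in> ideal2 a b" shows "f + g \<in> ideal2 a b"
proof -
  obtain x y x' y' where "f = a * x + b * y" "g = a * x' + b * y'"
    using assms by (auto simp: ideal2_iff)
  then have "f + g = a * (x + x') + b * (y + y')" by (simp add: algebra_simps)
  then show ?thesis unfolding ideal2_iff by blast
qed

lemma ideal2_mult:
  assumes "f \<in> ideal2 a b" shows "h * f \<in> ideal2 a b"
proof -
  obtain x y where "f = a * x + b * y"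
    using assms by (auto simp: ideal2_iff)
  then have "h * f = a * (h * x) + b * (h * y)" by (simp add: algebra_simps)
  then show ?thesis unfolding ideal2_iff by blast
qed

text \<open>A substitution that moves every variable only within \<open>(a, b)\<close> is the identity modulo \<open>(a, b)\<close>, so
  what it kills lies in \<open>(a, b)\<close>.  This is how the ideals generated by one or two linear forms are shown
  to be prime: they are kernels of endomorphisms of a domain.\<close>

lemma ideal2_eq_kernel:
  fixes a b :: "('k::field, 'n::finite) mpoly"
  assumes s: "\<And>i. var_poly i - s i \<in> ideal2 a b" and "subst s a = 0" "subst s b = 0"
  shows "f \<in> ideal2 a b \<longleftrightarrow> subst s f = 0"
proof
  assume "f \<in> ideal2 a b"
  then show "subst s f = 0"
    using assms(2,3) by (auto simp: ideal2_iff subst_add subst_mult)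
next
  have "f - subst s f \<in> ideal2 a b"
  proof (induction f rule: mpoly_algebra_induct)
    case (1 c)
    show ?case unfolding ideal2_iff subst_const by (intro exI[of _ 0]) simp
  next
    case (2 i)
    then show ?case using s by (simp add: subst_var)
  next
    case (3 f g)
    from ideal2_add[OF this] show ?case by (simp add: subst_add algebra_simps)
  next
    case (4 f g)
    have "f * g - subst s (f * g) = g * (f - subst s f) + subst s f * (g - subst s g)"
      by (simp add: subst_mult algebra_simps)
    with 4 show ?case by (simp add: ideal2_add ideal2_mult)
  qed
  then show "f \<in> ideal2 a b" if "subst s f = 0" using that by simp
qed

section \<open>Linear forms\<close>

abbreviation linear_form :: "('k::field ^ 'n \<Rightarrow> 'k) \<Rightarrow> bool"
  where "linear_form \<equiv> Vector_Spaces.linear (*s) (*)"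

lemma linear_form_add: "linear_form \<phi> \<Longrightarrow> \<phi> (v + w) = \<phi> v + \<phi> w"
  unfolding Vector_Spaces.linear_def module_hom_def module_hom_axioms_def by auto

lemma linear_form_scale: "linear_form \<phi> \<Longrightarrow> \<phi> (c *s v) = c * \<phi> v"
  unfolding Vector_Spaces.linear_def module_hom_def module_hom_axioms_def by auto

lemma linear_form_diff:
  fixes \<phi> :: "'k::field ^ 'n \<Rightarrow> 'k"
  assumes "linear_form \<phi>" shows "\<phi> (v - w) = \<phi> v - \<phi> w"
  using linear_form_add[OF assms, of "v - w" w] by simp

lemma linear_form_expand:
  fixes \<phi> :: "'k::field ^ 'n::finite \<Rightarrow> 'k"
  assumes "linear_form \<phi>"
  shows "\<phi> v = (\<Sum>i\<in>UNIV. \<phi> (axis i 1) * v $ i)"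
proof -
  have 0: "\<phi> 0 = 0" using linear_form_scale[OF assms, of 0 0] by simp
  have sum: "\<phi> (sum h I) = (\<Sum>i\<in>I. \<phi> (h i))" for h and I :: "'n set"
    by (induction I rule: infinite_finite_induct) (simp_all add: 0 linear_form_add[OF assms])
  have "\<phi> v = \<phi> (\<Sum>i\<in>UNIV. v $ i *s axis i 1)" by (simp only: basis_expansion)
  then show ?thesis by (simp add: sum linear_form_scale[OF assms] mult.commute)
qed

lemma form_poly_add: "form_poly (\<lambda>v. \<phi> v + \<psi> v) = form_poly \<phi> + form_poly \<psi>"
  by (simp add: form_poly_def const_poly_add distrib_right sum.distrib)

lemma form_poly_scale: "form_poly (\<lambda>v. c * \<phi> v) = const_poly c * form_poly \<phi>"
  by (simp add: form_poly_def const_poly_mult mult.assoc sum_distrib_left)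

lemma partial_form_poly:
  fixes \<phi> :: "'k::field ^ 'n::finite \<Rightarrow> 'k"
  shows "partial j (form_poly \<phi>) = const_poly (\<phi> (axis j 1))"
proof -
  have 0: "partial j 0 = (0 :: ('k, 'n) mpoly)" by (simp add: partial_def)
  have "partial j (sum h I) = (\<Sum>i\<in>I. partial j (h i))" for h :: "'n \<Rightarrow> ('k, 'n) mpoly" and I
    by (induction I rule: infinite_finite_induct) (simp_all add: 0 partial_add)
  then show ?thesis
    by (simp add: form_poly_def partial_mult partial_const partial_var mult_delta_right)
qed

lemma form_poly_inject:
  fixes \<phi> \<psi> :: "'k::field ^ 'n::finite \<Rightarrow> 'k"
  assumes "linear_form \<phi>" "linear_form \<psi>" and eq: "form_poly \<phi> = form_poly \<psi>"
  shows "\<phi> v = \<psi> v"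
proof -
  have "\<phi> (axis j 1) = \<psi> (axis j 1)" for j
    using partial_form_poly[of j \<phi>] partial_form_poly[of j \<psi>] eq by (simp add: const_poly_eq_iff)
  then show ?thesis
    by (simp add: linear_form_expand[OF assms(1), of v] linear_form_expand[OF assms(2), of v])
qed

text \<open>If \<open>a, b\<close> are forms dual to the vectors \<open>u, w\<close>, this substitution is composition with the linear
  projection \<open>v \<mapsto> v - a(v)u - b(v)w\<close> along \<open>u\<close> and \<open>w\<close>.\<close>

definition shift_vars :: "('k, 'n) mpoly \<Rightarrow> 'k ^ 'n \<Rightarrow> ('k, 'n) mpoly \<Rightarrow> 'k ^ 'n \<Rightarrow> 'n \<Rightarrow> ('k::field, 'n::finite) mpoly"
  where "shift_vars a u b w i = var_poly i - (const_poly (u $ i) * a + const_poly (w $ i) * b)"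

lemma subst_shift_form:
  fixes \<phi> :: "'k::field ^ 'n::finite \<Rightarrow> 'k"
  assumes "linear_form \<phi>"
  shows "subst (shift_vars a u b w) (form_poly \<phi>) =
    form_poly \<phi> - (const_poly (\<phi> u) * a + const_poly (\<phi> w) * b)"
  by (simp add: form_poly_def subst_sum subst_mult subst_const subst_var shift_vars_def
      linear_form_expand[OF assms, of u] linear_form_expand[OF assms, of w]
      const_poly_sum const_poly_mult sum_distrib_left sum_distrib_right sum_subtractf sum.distrib algebra_simps)

lemma ideal2_forms_iff:
  fixes \<phi> \<psi> :: "'k::field ^ 'n::finite \<Rightarrow> 'k"
  assumes lin: "linear_form \<phi>" "linear_form \<psi>"
    and dual: "\<phi> u = 1" "\<phi> w = 0" "\<psi> u = 0" "\<psi> w = 1"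
  shows "f \<in> ideal2 (form_poly \<phi>) (form_poly \<psi>) \<longleftrightarrow>
    subst (shift_vars (form_poly \<phi>) u (form_poly \<psi>) w) f = 0"
proof (rule ideal2_eq_kernel)
  show "var_poly i - shift_vars (form_poly \<phi>) u (form_poly \<psi>) w i \<in> ideal2 (form_poly \<phi>) (form_poly \<psi>)" for i
    unfolding ideal2_iff shift_vars_def
    by (intro exI[of _ "const_poly (u $ i)"] exI[of _ "const_poly (w $ i)"]) (simp add: mult.commute)
qed (simp_all add: subst_shift_form lin dual)

lemma prime_ideal2_forms:
  fixes \<phi> \<psi> :: "'k::field ^ 'n::finite \<Rightarrow> 'k"
  assumes "linear_form \<phi>" "linear_form \<psi>" "\<phi> u = 1" "\<phi> w = 0" "\<psi> u = 0" "\<psi> w = 1"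
    and "f * g \<in> ideal2 (form_poly \<phi>) (form_poly \<psi>)"
  shows "f \<in> ideal2 (form_poly \<phi>) (form_poly \<psi>) \<or> g \<in> ideal2 (form_poly \<phi>) (form_poly \<psi>)"
  using assms(7) unfolding ideal2_forms_iff[OF assms(1-6)] subst_mult
  using mpoly_no_zero_divisors by blast

lemma form_in_ideal2_forms:
  fixes \<phi> \<psi> \<xi> :: "'k::field ^ 'n::finite \<Rightarrow> 'k"
  assumes lin: "linear_form \<phi>" "linear_form \<psi>" "linear_form \<xi>"
    and dual: "\<phi> u = 1" "\<phi> w = 0" "\<psi> u = 0" "\<psi> w = 1"
    and mem: "form_poly \<xi> \<in> ideal2 (form_poly \<phi>) (form_poly \<psi>)"
  shows "\<xi> v = \<xi> u * \<phi> v + \<xi> w * \<psi> v"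
proof (rule form_poly_inject)
  show "linear_form (\<lambda>v. \<xi> u * \<phi> v + \<xi> w * \<psi> v)"
    using lin unfolding Vector_Spaces.linear_def module_hom_def module_hom_axioms_def
    by (auto simp: algebra_simps)
  show "form_poly \<xi> = form_poly (\<lambda>v. \<xi> u * \<phi> v + \<xi> w * \<psi> v)"
    using mem unfolding ideal2_forms_iff[OF lin(1,2) dual] subst_shift_form[OF lin(3)]
    by (simp add: form_poly_add form_poly_scale)
qed fact

lemma form_dvd_iff:
  fixes \<phi> :: "'k::field ^ 'n::finite \<Rightarrow> 'k"
  assumes "linear_form \<phi>" "\<phi> u = 1"
  shows "form_poly \<phi> dvd f \<longleftrightarrow> subst (shift_vars (form_poly \<phi>) u 0 0) f = 0"
proof -
  have "f \<in> ideal2 (form_poly \<phi>) 0 \<longleftrightarrow> subst (shift_vars (form_poly \<phi>) u 0 0) f = 0"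
  proof (rule ideal2_eq_kernel)
    show "var_poly i - shift_vars (form_poly \<phi>) u 0 0 i \<in> ideal2 (form_poly \<phi>) 0" for i
      unfolding ideal2_iff shift_vars_def
      by (intro exI[of _ "const_poly (u $ i)"]) (simp add: mult.commute)
    show "subst (shift_vars (form_poly \<phi>) u 0 0) (form_poly \<phi>) = 0"
      by (simp add: subst_shift_form assms)
    show "subst (shift_vars (form_poly \<phi>) u 0 0) 0 = 0"
      using subst_const[of _ 0] by simp
  qed
  then show ?thesis by (simp add: ideal2_iff dvd_def)
qed

lemma prime_form:
  fixes \<phi> :: "'k::field ^ 'n::finite \<Rightarrow> 'k"
  assumes "linear_form \<phi>" "\<phi> u = 1" "form_poly \<phi> dvd f * g"
  shows "form_poly \<phi> dvd f \<or> form_poly \<phi> dvd g"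
  using assms(3) unfolding form_dvd_iff[OF assms(1,2)] subst_mult
  using mpoly_no_zero_divisors by blast

lemma form_dvd_form:
  fixes \<phi> \<psi> :: "'k::field ^ 'n::finite \<Rightarrow> 'k"
  assumes lin: "linear_form \<phi>" "linear_form \<psi>" and u: "\<phi> u = 1"
    and dvd: "form_poly \<phi> dvd form_poly \<psi>"
  shows "\<psi> v = \<psi> u * \<phi> v"
proof (rule form_poly_inject)
  show "linear_form (\<lambda>v. \<psi> u * \<phi> v)"
    using lin unfolding Vector_Spaces.linear_def module_hom_def module_hom_axioms_def
    by (auto simp: algebra_simps)
  show "form_poly \<psi> = form_poly (\<lambda>v. \<psi> u * \<phi> v)"
    using dvd unfolding form_dvd_iff[OF lin(1) u] subst_shift_form[OF lin(2)]
    by (simp add: form_poly_scale)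
qed fact

section \<open>Hyperplanes\<close>

lemma hyperplane_subset_eq:
  fixes H L :: "('k::field ^ 'n::finite) set"
  assumes "hyperplane H" "hyperplane L" "H \<subseteq> L" shows "H = L"
  using assms vec.subspace_dim_equal[of H L] by (auto simp: hyperplane_def)

lemma defining_form_mem:
  assumes "defining_form UNIV \<phi> L" shows "v \<in> L \<longleftrightarrow> \<phi> v = 0"
  using assms by (auto simp: defining_form_def)

lemma defining_form_linear:
  assumes "defining_form W \<phi> L" shows "linear_form \<phi>"
  using assms by (auto simp: defining_form_def)

lemma hyperplane_unit_vector:
  fixes L :: "('k::field ^ 'n::finite) set"
  assumes L: "hyperplane L" and \<phi>: "defining_form UNIV \<phi> L"
  obtains u where "\<phi> u = 1"
proof -
  have "L \<noteq> UNIV" using L by (auto simp: hyperplane_def vec.dim_UNIV card_cart_basis)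
  then obtain v where "\<phi> v \<noteq> 0" using defining_form_mem[OF \<phi>] by auto
  then show thesis
    using that[of "inverse (\<phi> v) *s v"] linear_form_scale[OF defining_form_linear[OF \<phi>]] by simp
qed

lemma dual_vectors:
  fixes H L :: "('k::field ^ 'n::finite) set"
  assumes hyp: "hyperplane H" "hyperplane L" "H \<noteq> L"
    and \<phi>: "defining_form UNIV \<phi> H" and \<psi>: "defining_form UNIV \<psi> L"
  obtains u w where "\<phi> u = 1" "\<phi> w = 0" "\<psi> u = 0" "\<psi> w = 1"
proof -
  have "\<not> H \<subseteq> L" "\<not> L \<subseteq> H" using hyperplane_subset_eq hyp by blast+
  then obtain u w where "\<phi> u \<noteq> 0" "\<psi> u = 0" "\<phi> w = 0" "\<psi> w \<noteq> 0"
    using defining_form_mem[OF \<phi>] defining_form_mem[OF \<psi>] by auto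
  then show thesis
    using that[of "inverse (\<phi> u) *s u" "inverse (\<psi> w) *s w"]
      linear_form_scale[OF defining_form_linear[OF \<phi>]] linear_form_scale[OF defining_form_linear[OF \<psi>]]
    by simp
qed

text \<open>A form that vanishes on the intersection of two hyperplanes lies in their pencil, and its
  coefficients are its values on the dual vectors.\<close>

lemma form_poly_pencil:
  fixes \<phi> \<psi> \<xi> :: "'k::field ^ 'n::finite \<Rightarrow> 'k"
  assumes lin: "linear_form \<phi>" "linear_form \<psi>" "linear_form \<xi>"
    and dual: "\<phi> u = 1" "\<phi> w = 0" "\<psi> u = 0" "\<psi> w = 1"
    and vanish: "\<And>v. \<phi> v = 0 \<Longrightarrow> \<psi> v = 0 \<Longrightarrow> \<xi> v = 0"
  shows "form_poly \<xi> = const_poly (\<xi> u) * form_poly \<phi> + const_poly (\<xi> w) * form_poly \<psi>"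
proof -
  have "\<xi> v = \<xi> u * \<phi> v + \<xi> w * \<psi> v" for v
    using vanish[of "v - (\<phi> v *s u + \<psi> v *s w)"]
    by (simp add: linear_form_diff linear_form_add linear_form_scale lin dual algebra_simps)
  then have "form_poly \<xi> = form_poly (\<lambda>v. \<xi> u * \<phi> v + \<xi> w * \<psi> v)" by (metis ext)
  then show ?thesis by (simp add: form_poly_add form_poly_scale)
qed


section \<open>Logarithmic derivations\<close>

lemma derivation_add: "\<theta> \<in> derivations SV const_poly \<Longrightarrow> \<theta> (f + g) = \<theta> f + \<theta> g"
  by (simp add: derivations_SV_iff)

lemma derivation_mult: "\<theta> \<in> derivations SV const_poly \<Longrightarrow> \<theta> (f * g) = f * \<theta> g + g * \<theta> f"
  by (simp add: derivations_SV_iff)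

lemma derivation_const: "\<theta> \<in> derivations SV const_poly \<Longrightarrow> \<theta> (const_poly c) = 0"
  by (simp add: derivations_SV_iff)

lemmas derivation_simps = derivation_add derivation_mult derivation_const

lemma D_arr_iff:
  "\<theta> \<in> D_arr \<alpha> A \<longleftrightarrow> \<theta> \<in> derivations SV const_poly \<and>
    (\<forall>L\<in>A. form_poly (\<alpha> L) dvd \<theta> (form_poly (\<alpha> L)))"
  by (simp add: D_arr_def log_derivations_def form_ideal_def [symmetric] form_ideal_iff)

lemma carrier_D_arr_module: "carrier (D_arr_module \<alpha> A) = D_arr \<alpha> A"
  by (simp add: D_arr_module_def D_arr_def log_derivation_module_def)

lemma D_arr_module_ops:
  "\<theta> \<oplus>\<^bsub>D_arr_module \<alpha> A\<^esub> \<eta> = (\<lambda>f. \<theta> f + \<eta> f)" "h \<odot>\<^bsub>D_arr_module \<alpha> A\<^esub> \<theta> = (\<lambda>f. h * \<theta> f)"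
  by (simp_all add: D_arr_module_def log_derivation_module_def restrict_def)

lemma D_arr_mono: "B \<subseteq> A \<Longrightarrow> D_arr \<alpha> A \<subseteq> D_arr \<alpha> B"
  unfolding subset_iff D_arr_iff by blast

lemma D_arr_smult:
  assumes "\<theta> \<in> D_arr \<alpha> A" shows "(\<lambda>f. h * \<theta> f) \<in> D_arr \<alpha> A"
  using assms unfolding D_arr_iff derivations_SV_iff by (auto simp: algebra_simps)

lemma derivation_directional:
  "(\<lambda>f. \<Sum>i\<in>UNIV. (p * const_poly (u $ i) + q * const_poly (w $ i)) * partial i f) \<in> derivations SV const_poly"
  unfolding derivations_SV_eq by (intro range_eqI) (rule refl)

lemma directional_form_poly:
  fixes \<phi> :: "'k::field ^ 'n::finite \<Rightarrow> 'k"
  assumes "linear_form \<phi>"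
  shows "(\<Sum>i\<in>UNIV. (p * const_poly (u $ i) + q * const_poly (w $ i)) * partial i (form_poly \<phi>)) =
    p * const_poly (\<phi> u) + q * const_poly (\<phi> w)"
  by (simp add: partial_form_poly linear_form_expand[OF assms, of u] linear_form_expand[OF assms, of w]
      const_poly_sum const_poly_mult sum_distrib_left sum.distrib algebra_simps)

text \<open>With \<open>\<theta>(a) = as\<close> and \<open>\<theta>(b) = ar + bq\<close>, adding \<open>a(q - s)\<partial>\<^sub>u - ar\<partial>\<^sub>w\<close>, a multiple of \<open>a\<close>, turns these
  values into \<open>qa\<close> and \<open>qb\<close>.  The new derivation then multiplies each form of the pencil of \<open>a\<close> and \<open>b\<close>
  by \<open>q\<close>, so it is logarithmic along every hyperplane of the pencil.\<close>

lemma rank2_lift: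
  fixes \<phi> \<psi> :: "'k::field ^ 'n::finite \<Rightarrow> 'k"
  assumes lin: "linear_form \<phi>" "linear_form \<psi>"
    and dual: "\<phi> u = 1" "\<phi> w = 0" "\<psi> u = 0" "\<psi> w = 1"
    and \<theta>: "\<theta> \<in> derivations SV const_poly"
    and "form_poly \<phi> dvd \<theta> (form_poly \<phi>)" "\<theta> (form_poly \<psi>) \<in> ideal2 (form_poly \<phi>) (form_poly \<psi>)"
  obtains \<eta> q where "\<eta> \<in> derivations SV const_poly" "\<And>f. form_poly \<phi> dvd \<eta> f - \<theta> f"
    "\<eta> (form_poly \<phi>) = q * form_poly \<phi>" "\<eta> (form_poly \<psi>) = q * form_poly \<psi>"
proof -
  let ?a = "form_poly \<phi>" and ?b = "form_poly \<psi>"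
  obtain s where s: "\<theta> ?a = ?a * s" using assms(8) by (auto simp: dvd_def)
  obtain r q where rq: "\<theta> ?b = ?a * r + ?b * q" using assms(9) by (auto simp: ideal2_iff)
  define \<delta> where "\<delta> f = (\<Sum>i\<in>UNIV. (?a * (q - s) * const_poly (u $ i) + - (?a * r) * const_poly (w $ i)) * partial i f)" for f
  have \<delta>: "\<delta> \<in> derivations SV const_poly"
    unfolding \<delta>_def[abs_def] by (rule derivation_directional)
  have \<delta>_forms: "\<delta> ?a = ?a * (q - s)" "\<delta> ?b = - (?a * r)"
    unfolding \<delta>_def directional_form_poly[OF lin(1)] directional_form_poly[OF lin(2)] by (simp_all add: dual)
  have \<delta>_dvd: "?a dvd \<delta> f" for f
    unfolding \<delta>_def by (intro dvd_sum dvd_mult2 dvd_add) (simp_all add: mult.assoc)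
  show thesis
  proof (rule that)
    show "(\<lambda>f. \<theta> f + \<delta> f) \<in> derivations SV const_poly"
      using \<theta> \<delta> unfolding derivations_SV_iff by (simp add: algebra_simps)
    show "?a dvd \<theta> f + \<delta> f - \<theta> f" for f using \<delta>_dvd by simp
    show "\<theta> ?a + \<delta> ?a = q * ?a" by (simp add: s \<delta>_forms algebra_simps)
    show "\<theta> ?b + \<delta> ?b = q * ?b" by (simp add: rq \<delta>_forms algebra_simps)
  qed
qed

text \<open>The polynomial \<open>g\<close> is the product of the forms of the hyperplanes that do not contain \<open>H \<inter> L\<close>.  It
  makes the rank two lift logarithmic along these, and none of its factors lies in the prime ideal of
  \<open>H \<inter> L\<close>.\<close>

lemma local_lift:
  fixes A :: "('k::field ^ 'n::finite) set set"
  assumes A: "arrangement A" "H \<in> A" and form: "\<And>L. L \<in> A \<Longrightarrow> defining_form UNIV (\<alpha> L) L"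
    and L: "L \<in> A" "L \<noteq> H"
    and dual: "\<alpha> H u = 1" "\<alpha> H w = 0" "\<alpha> L u = 0" "\<alpha> L w = 1"
    and \<theta>: "\<theta> \<in> derivations SV const_poly" "form_poly (\<alpha> H) dvd \<theta> (form_poly (\<alpha> H))"
      "\<theta> (form_poly (\<alpha> L)) \<in> ideal2 (form_poly (\<alpha> H)) (form_poly (\<alpha> L))"
  obtains g \<eta> where "g \<notin> ideal2 (form_poly (\<alpha> H)) (form_poly (\<alpha> L))" "\<eta> \<in> D_arr \<alpha> A"
    "\<And>f. form_poly (\<alpha> H) dvd \<eta> f - g * \<theta> f"
proof -
  let ?a = "form_poly (\<alpha> H)" and ?b = "form_poly (\<alpha> L)"
  have fin: "finite A" using A by (simp add: arrangement_def)
  have lin: "linear_form (\<alpha> M)" and mem: "v \<in> M \<longleftrightarrow> \<alpha> M v = 0" if "M \<in> A" for M v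
    using form[OF that] by (simp_all add: defining_form_linear defining_form_mem)
  note linHL = lin[OF A(2)] lin[OF L(1)]
  define N where "N = {M \<in> A. \<not> H \<inter> L \<subseteq> M}"
  define g where "g = (\<Prod>M\<in>N. form_poly (\<alpha> M))"
  obtain \<eta> q where \<eta>: "\<eta> \<in> derivations SV const_poly" "\<And>f. ?a dvd \<eta> f - \<theta> f"
    "\<eta> ?a = q * ?a" "\<eta> ?b = q * ?b"
    using rank2_lift[OF linHL dual \<theta>] by blast
  have "g \<notin> ideal2 ?a ?b"
  proof -
    have "(\<Prod>M\<in>N'. form_poly (\<alpha> M)) \<notin> ideal2 ?a ?b" if "finite N'" "N' \<subseteq> N" for N'
      using that
    proof (induction N' rule: finite_induct)
      case empty
      have "1 \<notin> ideal2 ?a ?b"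
        unfolding ideal2_forms_iff[OF linHL dual] by (simp add: subst_one)
      then show ?case by simp
    next
      case (insert M N')
      then have M: "M \<in> A" "\<not> H \<inter> L \<subseteq> M" by (auto simp: N_def)
      have "form_poly (\<alpha> M) \<notin> ideal2 ?a ?b"
      proof
        assume *: "form_poly (\<alpha> M) \<in> ideal2 ?a ?b"
        have "H \<inter> L \<subseteq> M"
        proof
          fix v assume "v \<in> H \<inter> L"
          then show "v \<in> M"
            using form_in_ideal2_forms[OF linHL lin[OF M(1)] dual *, of v]
            by (simp add: mem M(1) L(1) A(2))
        qed
        with M(2) show False ..
      qed
      then show ?case using insert prime_ideal2_forms[OF linHL dual] by auto
    qed
    then show ?thesis using fin by (simp add: g_def N_def)
  qed
  moreover have "(\<lambda>f. g * \<eta> f) \<in> D_arr \<alpha> A"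
    unfolding D_arr_iff
  proof (intro conjI ballI)
    show "(\<lambda>f. g * \<eta> f) \<in> derivations SV const_poly"
      using \<eta>(1) unfolding derivations_SV_iff by (simp add: algebra_simps)
    fix M assume M: "M \<in> A"
    show "form_poly (\<alpha> M) dvd g * \<eta> (form_poly (\<alpha> M))"
    proof (cases "M \<in> N")
      case True
      then have "form_poly (\<alpha> M) dvd g"
        unfolding g_def using fin by (intro dvd_prodI) (auto simp: N_def)
      then show ?thesis by (rule dvd_mult2)
    next
      case False
      then have "H \<inter> L \<subseteq> M" using M by (simp add: N_def)
      then have "form_poly (\<alpha> M) = const_poly (\<alpha> M u) * ?a + const_poly (\<alpha> M w) * ?b"
        by (intro form_poly_pencil[OF linHL lin[OF M] dual]) (auto simp: mem M L(1) A(2))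
      then have "\<eta> (form_poly (\<alpha> M)) = q * form_poly (\<alpha> M)"
        using \<eta>(1) by (simp add: derivation_simps \<eta>(3,4) algebra_simps)
      then show ?thesis by simp
    qed
  qed
  moreover have "?a dvd g * \<eta> f - g * \<theta> f" for f
    using \<eta>(2)[of f] by (simp flip: right_diff_distrib)
  ultimately show thesis by (rule that)
qed

text \<open>This is the step that needs projective dimension zero.  Comparing the lifts \<open>\<zeta>\<close> of \<open>bf\<theta>\<close> and \<open>\<eta>\<close> of
  \<open>g\<theta>\<close>, the derivation \<open>g\<zeta> - bf\<eta>\<close> is divisible by \<open>a\<close>; the quotient \<open>\<kappa>\<close> is logarithmic along the
  hyperplanes other than \<open>H\<close>, because their forms are prime and do not divide \<open>a\<close>, but possibly not along
  \<open>H\<close>.  So the resulting relation holds in \<open>D(A - {H})\<close>, and this is the module in which \<open>\<zeta>\<close> is divided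
  by \<open>b\<close>.\<close>

lemma cancel_factor:
  fixes A :: "('k::field ^ 'n::finite) set set"
  assumes A: "arrangement A" "H \<in> A" and form: "\<And>L. L \<in> A \<Longrightarrow> defining_form UNIV (\<alpha> L) L"
    and pd: "pd_arr \<alpha> (A - {H}) = 0"
    and L: "L \<in> A" "L \<noteq> H"
    and dual: "\<alpha> H u = 1" "\<alpha> H w = 0" "\<alpha> L u = 0" "\<alpha> L w = 1"
    and g: "g \<notin> ideal2 (form_poly (\<alpha> H)) (form_poly (\<alpha> L))"
    and \<eta>: "\<eta> \<in> D_arr \<alpha> A" "\<And>x. form_poly (\<alpha> H) dvd \<eta> x - g * \<theta> x"
    and \<zeta>: "\<zeta> \<in> D_arr \<alpha> A" "\<And>x. form_poly (\<alpha> H) dvd \<zeta> x - form_poly (\<alpha> L) * f * \<theta> x"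
    and \<theta>: "form_poly (\<alpha> H) dvd \<theta> (form_poly (\<alpha> H))"
  shows "\<exists>\<xi>\<in>D_arr \<alpha> A. \<forall>x. form_poly (\<alpha> H) dvd \<xi> x - f * \<theta> x"
proof -
  let ?a = "form_poly (\<alpha> H)" and ?b = "form_poly (\<alpha> L)"
  let ?D = "D_arr_module \<alpha> (A - {H})"
  have lin: "linear_form (\<alpha> M)" and mem: "v \<in> M \<longleftrightarrow> \<alpha> M v = 0" and hyp: "hyperplane M" if "M \<in> A" for M v
    using form[OF that] A that by (simp_all add: defining_form_linear defining_form_mem arrangement_def)
  note linHL = lin[OF A(2)] lin[OF L(1)]
  have not_dvd: "\<not> form_poly (\<alpha> M) dvd form_poly (\<alpha> M')" if M: "M \<in> A" "M' \<in> A" "M \<noteq> M'" for M M'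
  proof
    assume dvd: "form_poly (\<alpha> M) dvd form_poly (\<alpha> M')"
    obtain t where t: "\<alpha> M t = 1" using hyperplane_unit_vector hyp form M(1) by metis
    have "M \<subseteq> M'"
      unfolding subset_iff mem[OF M(1)] mem[OF M(2)]
      using form_dvd_form[OF lin[OF M(1)] lin[OF M(2)] t dvd] by (metis mult_zero_right)
    then show False using hyperplane_subset_eq hyp M by blast
  qed
  have a0: "?a \<noteq> 0" using not_dvd[OF L(1) A(2) L(2)] by auto
  have cancel_a: "x = y" if "?a * x = ?a * y" for x y
    using mpoly_no_zero_divisors[OF a0, of "x - y"] that by (auto simp: algebra_simps)
  have "?a dvd g * \<zeta> x - ?b * f * \<eta> x" for x
  proof -
    have "g * \<zeta> x - ?b * f * \<eta> x = g * (\<zeta> x - ?b * f * \<theta> x) - ?b * f * (\<eta> x - g * \<theta> x)"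
      by (simp add: algebra_simps)
    then show ?thesis using \<eta>(2)[of x] \<zeta>(2)[of x] by (simp add: dvd_mult dvd_diff)
  qed
  then have "\<forall>x. \<exists>y. g * \<zeta> x - ?b * f * \<eta> x = ?a * y" by (simp add: dvd_def)
  then obtain \<kappa> where \<kappa>: "\<And>x. g * \<zeta> x - ?b * f * \<eta> x = ?a * \<kappa> x" by metis
  have \<eta>_der: "\<eta> \<in> derivations SV const_poly" and \<zeta>_der: "\<zeta> \<in> derivations SV const_poly"
    using \<eta>(1) \<zeta>(1) by (auto simp: D_arr_iff)
  have \<kappa>_D: "\<kappa> \<in> D_arr \<alpha> (A - {H})"
    unfolding D_arr_iff derivations_SV_iff
  proof (intro conjI allI ballI)
    show "\<kappa> (x + y) = \<kappa> x + \<kappa> y" for x y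
      by (rule cancel_a) (simp only: \<kappa>[symmetric] distrib_left derivation_simps[OF \<eta>_der] derivation_simps[OF \<zeta>_der],
          simp add: algebra_simps)
    show "\<kappa> (x * y) = x * \<kappa> y + y * \<kappa> x" for x y
      by (rule cancel_a)
        (simp add: distrib_left mult.left_commute[of ?a] \<kappa>[symmetric] derivation_simps[OF \<eta>_der] derivation_simps[OF \<zeta>_der],
          simp add: algebra_simps)
    show "\<kappa> (const_poly c) = 0" for c
      by (rule cancel_a) (simp add: \<kappa>[symmetric] derivation_simps[OF \<eta>_der] derivation_simps[OF \<zeta>_der])
    fix M assume M: "M \<in> A - {H}"
    obtain t where t: "\<alpha> M t = 1" using hyperplane_unit_vector hyp form M by (metis DiffD1)
    have "form_poly (\<alpha> M) dvd ?a * \<kappa> (form_poly (\<alpha> M))"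
      unfolding \<kappa>[symmetric] using \<eta>(1) \<zeta>(1) M by (auto simp: D_arr_iff intro!: dvd_diff dvd_mult)
    then show "form_poly (\<alpha> M) dvd \<kappa> (form_poly (\<alpha> M))"
      using prime_form[OF lin t] not_dvd[of M H] M A(2) by blast
  qed
  have sub: "D_arr \<alpha> A \<subseteq> D_arr \<alpha> (A - {H})" by (rule D_arr_mono) auto
  have f\<eta>_D: "(\<lambda>x. f * \<eta> x) \<in> D_arr \<alpha> (A - {H})" using \<eta>(1) sub by (intro D_arr_smult) auto
  have eq: "g \<odot>\<^bsub>?D\<^esub> \<zeta> = ?b \<odot>\<^bsub>?D\<^esub> (\<lambda>x. f * \<eta> x) \<oplus>\<^bsub>?D\<^esub> ?a \<odot>\<^bsub>?D\<^esub> \<kappa>"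
    unfolding D_arr_module_ops \<kappa>[symmetric] by (simp add: mult.assoc)
  have "\<exists>\<xi>\<in>carrier ?D. \<exists>\<mu>\<in>carrier ?D. \<zeta> = ?b \<odot>\<^bsub>?D\<^esub> \<xi> \<oplus>\<^bsub>?D\<^esub> ?a \<odot>\<^bsub>?D\<^esub> \<mu>"
  proof (rule proj_dim_zero_divisible[OF module_D_arr pd[unfolded pd_arr_def] _ _ _ _ _ _ eq])
    fix c d e assume "g \<otimes>\<^bsub>SV\<^esub> c = ?b \<otimes>\<^bsub>SV\<^esub> d \<oplus>\<^bsub>SV\<^esub> ?a \<otimes>\<^bsub>SV\<^esub> e"
    then have "g * c = ?a * e + ?b * d" by (simp add: add.commute)
    then have "c \<in> ideal2 ?a ?b" using prime_ideal2_forms[OF linHL dual, of g c] g by (auto simp: ideal2_iff)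
    then show "\<exists>d'\<in>carrier SV. \<exists>e'\<in>carrier SV. c = ?b \<otimes>\<^bsub>SV\<^esub> d' \<oplus>\<^bsub>SV\<^esub> ?a \<otimes>\<^bsub>SV\<^esub> e'"
      by (auto simp: ideal2_iff add.commute)
  qed (use \<zeta>(1) sub f\<eta>_D \<kappa>_D in \<open>auto simp: carrier_D_arr_module\<close>)
  then obtain \<xi> \<mu> where \<xi>: "\<xi> \<in> D_arr \<alpha> (A - {H})" and \<zeta>_eq: "\<And>x. \<zeta> x = ?b * \<xi> x + ?a * \<mu> x"
    by (auto simp: carrier_D_arr_module D_arr_module_ops)
  \<comment> \<open>The quotient \<open>\<xi>\<close> agrees with \<open>f\<theta>\<close> modulo \<open>a\<close>, so it preserves the ideal of \<open>a\<close> as \<open>\<theta>\<close> does; this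
    puts it back into \<open>D(A)\<close>.\<close>
  have \<xi>_dvd: "?a dvd \<xi> x - f * \<theta> x" for x
  proof -
    have "?b * (\<xi> x - f * \<theta> x) = (\<zeta> x - ?b * f * \<theta> x) - ?a * \<mu> x"
      by (simp add: \<zeta>_eq algebra_simps)
    then have "?a dvd ?b * (\<xi> x - f * \<theta> x)" using \<zeta>(2)[of x] by (simp add: dvd_diff)
    then show ?thesis using prime_form[OF linHL(1) dual(1)] not_dvd[OF A(2) L(1)] L(2) by blast
  qed
  have "?a dvd \<xi> ?a" using dvd_add[OF \<xi>_dvd[of ?a] dvd_mult[OF \<theta>, of f]] by simp
  then have "\<xi> \<in> D_arr \<alpha> A" using \<xi> by (auto simp: D_arr_iff)
  with \<xi>_dvd show ?thesis by blast
qed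

text \<open>The multiple of \<open>\<theta>\<close> by all the forms of \<open>A - {H}\<close> is logarithmic along \<open>A\<close>, and the forms are
  cancelled from it one by one.\<close>

lemma lift_to_D_arr:
  fixes A :: "('k::field ^ 'n::finite) set set"
  assumes A: "arrangement A" "H \<in> A" and form: "\<And>L. L \<in> A \<Longrightarrow> defining_form UNIV (\<alpha> L) L"
    and pd: "pd_arr \<alpha> (A - {H}) = 0"
    and \<theta>: "\<theta> \<in> derivations SV const_poly" "form_poly (\<alpha> H) dvd \<theta> (form_poly (\<alpha> H))"
    and log: "\<And>L. L \<in> A - {H} \<Longrightarrow> \<theta> (form_poly (\<alpha> L)) \<in> ideal2 (form_poly (\<alpha> H)) (form_poly (\<alpha> L))"
  shows "\<exists>\<xi>\<in>D_arr \<alpha> A. \<forall>x. form_poly (\<alpha> H) dvd \<xi> x - \<theta> x"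
proof -
  let ?a = "form_poly (\<alpha> H)"
  define P where "P f \<longleftrightarrow> (\<exists>\<xi>\<in>D_arr \<alpha> A. \<forall>x. ?a dvd \<xi> x - f * \<theta> x)" for f
  have cancel: "P f" if L: "L \<in> A - {H}" and Pf: "P (form_poly (\<alpha> L) * f)" for L f
  proof -
    obtain u w where dual: "\<alpha> H u = 1" "\<alpha> H w = 0" "\<alpha> L u = 0" "\<alpha> L w = 1"
      using dual_vectors[of H L "\<alpha> H" "\<alpha> L"] A L form by (metis DiffD1 DiffD2 arrangement_def insertI1)
    obtain g \<eta> where "g \<notin> ideal2 ?a (form_poly (\<alpha> L))" "\<eta> \<in> D_arr \<alpha> A" "\<And>x. ?a dvd \<eta> x - g * \<theta> x"
      using local_lift[OF A form _ _ dual \<theta> log] L by blast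
    with Pf show ?thesis
      using cancel_factor[OF A form pd _ _ dual] L \<theta>(2) unfolding P_def by blast
  qed
  have "P 1" if "finite F" "F \<subseteq> A - {H}" "P (\<Prod>L\<in>F. form_poly (\<alpha> L))" for F
    using that
  proof (induction F rule: finite_induct)
    case (insert L F)
    then have "P (form_poly (\<alpha> L) * (\<Prod>L\<in>F. form_poly (\<alpha> L)))" by simp
    then have "P (\<Prod>L\<in>F. form_poly (\<alpha> L))" using cancel insert.prems(1) by blast
    with insert show ?case by blast
  qed simp
  moreover have fin: "finite (A - {H})" using A by (simp add: arrangement_def)
  moreover have "P (\<Prod>L\<in>A - {H}. form_poly (\<alpha> L))"
    unfolding P_def
  proof (rule bexI)
    let ?Q = "\<Prod>L\<in>A - {H}. form_poly (\<alpha> L)"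
    show "\<forall>x. ?a dvd ?Q * \<theta> x - ?Q * \<theta> x" by simp
    have "form_poly (\<alpha> L) dvd ?Q * \<theta> (form_poly (\<alpha> L))" if "L \<in> A" for L
      using that \<theta>(2) fin by (cases "L = H") (auto intro: dvd_mult dvd_mult2 dvd_prodI)
    then show "(\<lambda>x. ?Q * \<theta> x) \<in> D_arr \<alpha> A"
      using \<theta>(1) unfolding D_arr_iff derivations_SV_iff by (simp add: algebra_simps)
  qed
  ultimately have "P 1" by blast
  then show ?thesis by (simp add: P_def)
qed


section \<open>Derivations of the coordinate ring of a hyperplane\<close>

lemma ideal_form_ideal: "ideal (form_ideal \<phi>) SV"
  unfolding form_ideal_def by (rule cring.cgenideal_ideal[OF cring_from_type_algebra]) simp

lemma SH_simps:
  "carrier (SH \<phi>) = range (reduce \<phi>)"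
  "\<zero>\<^bsub>SH \<phi>\<^esub> = reduce \<phi> 0"
  "reduce \<phi> f \<oplus>\<^bsub>SH \<phi>\<^esub> reduce \<phi> g = reduce \<phi> (f + g)"
  "reduce \<phi> f \<otimes>\<^bsub>SH \<phi>\<^esub> reduce \<phi> g = reduce \<phi> (f * g)"
proof -
  interpret ideal "form_ideal \<phi>" SV by (rule ideal_form_ideal)
  show "carrier (SH \<phi>) = range (reduce \<phi>)"
    by (auto simp: SH_def FactRing_def A_RCOSETS_def' reduce_def)
  show "\<zero>\<^bsub>SH \<phi>\<^esub> = reduce \<phi> 0"
    by (auto simp: SH_def FactRing_def reduce_eq)
  show "reduce \<phi> f \<oplus>\<^bsub>SH \<phi>\<^esub> reduce \<phi> g = reduce \<phi> (f + g)"
    by (simp add: SH_def FactRing_def reduce_def a_rcos_sum)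
  show "reduce \<phi> f \<otimes>\<^bsub>SH \<phi>\<^esub> reduce \<phi> g = reduce \<phi> (f * g)"
    by (simp add: SH_def FactRing_def reduce_def rcoset_mult_add)
qed

lemma reduce_mem_PIdl: "reduce \<phi> f \<in> PIdl\<^bsub>SH \<phi>\<^esub> (reduce \<phi> g) \<longleftrightarrow> f \<in> ideal2 (form_poly \<phi>) g"
proof -
  have "reduce \<phi> f \<in> PIdl\<^bsub>SH \<phi>\<^esub> (reduce \<phi> g) \<longleftrightarrow> (\<exists>h. reduce \<phi> f = reduce \<phi> h \<otimes>\<^bsub>SH \<phi>\<^esub> reduce \<phi> g)"
    by (auto simp: cgenideal_def SH_simps(1))
  also have "\<dots> \<longleftrightarrow> (\<exists>h. form_poly \<phi> dvd f - h * g)"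
    by (simp add: SH_simps(4) reduce_eq_iff)
  also have "\<dots> \<longleftrightarrow> (\<exists>h x. f = form_poly \<phi> * x + g * h)"
    unfolding dvd_def by (metis add_diff_cancel_right' diff_add_cancel mult.commute)
  finally show ?thesis unfolding ideal2_iff by blast
qed

lemma D_restr_iff:
  "\<Theta> \<in> D_restr \<phi> \<beta> B \<longleftrightarrow> \<Theta> \<in> range (reduce \<phi>) \<rightarrow>\<^sub>E range (reduce \<phi>) \<and>
    (\<forall>f g. \<Theta> (reduce \<phi> (f + g)) = \<Theta> (reduce \<phi> f) \<oplus>\<^bsub>SH \<phi>\<^esub> \<Theta> (reduce \<phi> g)) \<and>
    (\<forall>f g. \<Theta> (reduce \<phi> (f * g)) =
      (reduce \<phi> f \<otimes>\<^bsub>SH \<phi>\<^esub> \<Theta> (reduce \<phi> g)) \<oplus>\<^bsub>SH \<phi>\<^esub> (reduce \<phi> g \<otimes>\<^bsub>SH \<phi>\<^esub> \<Theta> (reduce \<phi> f))) \<and>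
    (\<forall>k. \<Theta> (reduce \<phi> (const_poly k)) = reduce \<phi> 0) \<and>
    (\<forall>Z\<in>B. \<Theta> (reduce \<phi> (form_poly (\<beta> Z))) \<in> PIdl\<^bsub>SH \<phi>\<^esub> (reduce \<phi> (form_poly (\<beta> Z))))"
  by (simp add: D_restr_def log_derivations_def derivations_def SH_simps(1,2) SH_simps(3,4)[symmetric])

text \<open>The coordinate ring of \<open>H\<close> is generated by the classes of the variables, and the values of a
  derivation of the polynomial ring on the variables can be prescribed.\<close>

lemma derivation_SH_lift:
  assumes "\<Theta> \<in> D_restr \<phi> \<beta> B"
  obtains \<theta> where "\<theta> \<in> derivations SV const_poly" "\<And>f. \<Theta> (reduce \<phi> f) = reduce \<phi> (\<theta> f)"
proof -
  note \<Theta> = assms[unfolded D_restr_iff]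
  have "\<Theta> (reduce \<phi> (var_poly i)) \<in> range (reduce \<phi>)" for i
    using \<Theta> by (auto simp: PiE_iff)
  then have "\<forall>i. \<exists>h. \<Theta> (reduce \<phi> (var_poly i)) = reduce \<phi> h" by blast
  then obtain h where h: "\<And>i. \<Theta> (reduce \<phi> (var_poly i)) = reduce \<phi> (h i)" by metis
  define \<theta> where "\<theta> f = (\<Sum>i\<in>UNIV. h i * partial i f)" for f
  have \<theta>: "\<theta> \<in> derivations SV const_poly"
    unfolding derivations_SV_eq \<theta>_def[abs_def] by (intro range_eqI) (rule refl)
  have "\<Theta> (reduce \<phi> f) = reduce \<phi> (\<theta> f)" for f
  proof (induction f rule: mpoly_algebra_induct)
    case (1 c)
    then show ?case using \<Theta> by (simp add: derivation_const[OF \<theta>])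
  next
    case (2 i)
    have "\<theta> (var_poly i) = h i" by (simp add: \<theta>_def partial_var mult_delta_right)
    then show ?case by (simp add: h)
  next
    case (3 f g)
    then show ?case using \<Theta> by (simp add: derivation_add[OF \<theta>] SH_simps(3))
  next
    case (4 f g)
    then show ?case using \<Theta> by (simp add: derivation_mult[OF \<theta>] SH_simps(3,4))
  qed
  with \<theta> show thesis by (rule that)
qed

lemma log_change_form_aux:
  fixes a b b' :: "('k::field, 'n::finite) mpoly"
  assumes \<theta>: "\<theta> \<in> derivations SV const_poly" "a dvd \<theta> a"
    and b': "b' = const_poly c * a + const_poly d * b" and d: "d \<noteq> 0"
    and "\<theta> b' \<in> ideal2 a b'"
  shows "\<theta> b \<in> ideal2 a b"
proof -
  obtain s where s: "\<theta> a = a * s" using \<theta>(2) by (auto simp: dvd_def)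
  obtain x y where "\<theta> b' = a * x + b' * y" using assms(5) by (auto simp: ideal2_iff)
  then have "const_poly d * \<theta> b = a * (x + const_poly c * y - const_poly c * s) + b * (const_poly d * y)"
    unfolding b' by (simp add: derivation_simps[OF \<theta>(1)] s algebra_simps)
  then have "const_poly d * \<theta> b \<in> ideal2 a b" unfolding ideal2_iff by blast
  from ideal2_mult[OF this, of "const_poly (inverse d)"] show ?thesis
    by (simp add: const_poly_inverse d)
qed

text \<open>The hyperplane \<open>H \<inter> L\<close> of \<open>H\<close> is cut out by the form of \<open>L\<close> as well as by the chosen form of
  \<open>H \<inter> L\<close>.  These agree modulo \<open>a\<close> up to a nonzero scalar, which does not affect the logarithmic
  condition modulo \<open>a\<close>.\<close>

lemma log_change_form:
  fixes a b b' :: "('k::field, 'n::finite) mpoly"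
  assumes \<theta>: "\<theta> \<in> derivations SV const_poly" "a dvd \<theta> a"
    and b': "b' = const_poly c * a + const_poly d * b" and d: "d \<noteq> 0"
  shows "\<theta> b' \<in> ideal2 a b' \<longleftrightarrow> \<theta> b \<in> ideal2 a b"
proof
  show "\<theta> b \<in> ideal2 a b" if "\<theta> b' \<in> ideal2 a b'"
    using log_change_form_aux[OF \<theta> b' d that] .
  have "b = const_poly (- inverse d * c) * a + const_poly (inverse d) * b'"
    by (simp add: b' distrib_left const_poly_inverse[OF d] const_poly_mult const_poly_uminus mult.assoc)
  then show "\<theta> b' \<in> ideal2 a b'" if "\<theta> b \<in> ideal2 a b"
    using log_change_form_aux[OF \<theta> _ _ that, of "- inverse d * c" "inverse d" b'] d by simp
qed

lemma restricted_form:
  fixes H L :: "('k::field ^ 'n::finite) set"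
  assumes hyp: "hyperplane H" "hyperplane L" "H \<noteq> L"
    and \<phi>: "defining_form UNIV \<phi> H" and \<psi>: "defining_form UNIV \<psi> L" and \<xi>: "defining_form H \<xi> (H \<inter> L)"
  obtains c d where "form_poly \<xi> = const_poly c * form_poly \<phi> + const_poly d * form_poly \<psi>" "d \<noteq> 0"
proof -
  obtain u w where dual: "\<phi> u = 1" "\<phi> w = 0" "\<psi> u = 0" "\<psi> w = 1"
    using dual_vectors[OF hyp \<phi> \<psi>] .
  note mem = defining_form_mem[OF \<phi>] defining_form_mem[OF \<psi>]
  have \<xi>_mem: "\<xi> v = 0 \<longleftrightarrow> \<psi> v = 0" if "\<phi> v = 0" for v
    using \<xi> that mem by (auto simp: defining_form_def)
  show thesis
  proof (rule that)
    show "form_poly \<xi> = const_poly (\<xi> u) * form_poly \<phi> + const_poly (\<xi> w) * form_poly \<psi>"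
      using form_poly_pencil[OF \<phi>[THEN defining_form_linear] \<psi>[THEN defining_form_linear]
          \<xi>[THEN defining_form_linear] dual] \<xi>_mem by blast
    show "\<xi> w \<noteq> 0" using \<xi>_mem[of w] dual by simp
  qed
qed

theorem theorem1p13:
  fixes A :: "('k::field ^ 'n::finite) set set"
    and H :: "('k ^ 'n) set"
    and \<alpha> \<beta> :: "('k ^ 'n) set \<Rightarrow> ('k ^ 'n \<Rightarrow> 'k)"
  assumes "arrangement A"
    and "H \<in> A"
    and "\<And>L. L \<in> A \<Longrightarrow> defining_form UNIV (\<alpha> L) L"
    and "\<And>Z. Z \<in> restr_arrangement A H \<Longrightarrow> defining_form H (\<beta> Z) Z"
    and "pd_arr \<alpha> (A - {H}) = 0"
  shows "euler_restriction (\<alpha> H) ` D_arr \<alpha> A = D_restr (\<alpha> H) \<beta> (restr_arrangement A H)"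
proof -
  let ?a = "form_poly (\<alpha> H)" and ?r = "reduce (\<alpha> H)"
  have change: "\<theta> (form_poly (\<beta> (H \<inter> L))) \<in> ideal2 ?a (form_poly (\<beta> (H \<inter> L))) \<longleftrightarrow>
      \<theta> (form_poly (\<alpha> L)) \<in> ideal2 ?a (form_poly (\<alpha> L))"
    if \<theta>: "\<theta> \<in> derivations SV const_poly" "?a dvd \<theta> ?a" and L: "L \<in> A - {H}" for \<theta> L
  proof -
    have "H \<inter> L \<in> restr_arrangement A H" using L by (auto simp: restr_arrangement_def)
    moreover have "hyperplane H" "hyperplane L" "H \<noteq> L"
      using assms(1,2) L by (auto simp: arrangement_def)
    ultimately obtain c d where
      "form_poly (\<beta> (H \<inter> L)) = const_poly c * ?a + const_poly d * form_poly (\<alpha> L)" "d \<noteq> 0"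
      using restricted_form[of H L "\<alpha> H" "\<alpha> L" "\<beta> (H \<inter> L)"] assms(2-4) L by blast
    then show ?thesis by (rule log_change_form[OF \<theta>])
  qed
  show ?thesis
  proof (intro equalityI subsetI)
    fix \<Theta> assume "\<Theta> \<in> euler_restriction (\<alpha> H) ` D_arr \<alpha> A"
    then obtain \<theta> where \<theta>: "\<theta> \<in> D_arr \<alpha> A" and \<Theta>: "\<Theta> = euler_restriction (\<alpha> H) \<theta>" by blast
    have \<theta>_der: "\<theta> \<in> derivations SV const_poly" and \<theta>_a: "?a dvd \<theta> ?a"
      using \<theta> assms(2) by (auto simp: D_arr_iff)
    have \<Theta>_r: "\<Theta> (?r f) = ?r (\<theta> f)" for f
      unfolding \<Theta> by (rule euler_restriction_reduce[OF \<theta> assms(2)])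
    show "\<Theta> \<in> D_restr (\<alpha> H) \<beta> (restr_arrangement A H)"
      unfolding D_restr_iff \<Theta>_r SH_simps reduce_mem_PIdl
    proof (intro conjI allI ballI)
      show "\<Theta> \<in> range ?r \<rightarrow>\<^sub>E range ?r"
      proof (rule PiE_I)
        show "\<Theta> Y \<in> range ?r" if "Y \<in> range ?r" for Y using that \<Theta>_r by auto
        show "\<Theta> Y = undefined" if "Y \<notin> range ?r" for Y
          using that by (simp add: \<Theta> euler_restriction_def SH_simps(1))
      qed
      fix Z assume "Z \<in> restr_arrangement A H"
      then obtain L where L: "L \<in> A - {H}" "Z = H \<inter> L" by (auto simp: restr_arrangement_def)
      then have "form_poly (\<alpha> L) dvd \<theta> (form_poly (\<alpha> L))" using \<theta> by (auto simp: D_arr_iff)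
      then have "\<theta> (form_poly (\<alpha> L)) \<in> ideal2 ?a (form_poly (\<alpha> L))"
        unfolding ideal2_iff dvd_def by (metis add_0 mult_zero_right)
      then show "\<theta> (form_poly (\<beta> Z)) \<in> ideal2 ?a (form_poly (\<beta> Z))"
        using change[OF \<theta>_der \<theta>_a L(1)] L(2) by simp
    qed (simp_all add: derivation_simps[OF \<theta>_der])
  next
    fix \<Theta> assume \<Theta>: "\<Theta> \<in> D_restr (\<alpha> H) \<beta> (restr_arrangement A H)"
    then obtain \<theta> where \<theta>: "\<theta> \<in> derivations SV const_poly" and \<Theta>_r: "\<And>f. \<Theta> (?r f) = ?r (\<theta> f)"
      using derivation_SH_lift by blast
    have "?r (\<theta> ?a) = \<Theta> (?r 0)"
      unfolding \<Theta>_r[symmetric] by (rule arg_cong[where f = \<Theta>]) (simp add: reduce_eq_iff)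
    also have "\<dots> = ?r 0" using \<Theta>_r[of "const_poly 0"] derivation_const[OF \<theta>, of 0] by simp
    finally have \<theta>_a: "?a dvd \<theta> ?a" by (simp add: reduce_eq_iff)
    have "\<theta> (form_poly (\<alpha> L)) \<in> ideal2 ?a (form_poly (\<alpha> L))" if L: "L \<in> A - {H}" for L
    proof -
      have "H \<inter> L \<in> restr_arrangement A H" using L by (auto simp: restr_arrangement_def)
      then have "\<theta> (form_poly (\<beta> (H \<inter> L))) \<in> ideal2 ?a (form_poly (\<beta> (H \<inter> L)))"
        using \<Theta> unfolding D_restr_iff \<Theta>_r reduce_mem_PIdl by blast
      then show ?thesis using change[OF \<theta> \<theta>_a L] by simp
    qed
    then obtain \<xi> where \<xi>: "\<xi> \<in> D_arr \<alpha> A" "\<And>f. ?a dvd \<xi> f - \<theta> f"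
      using lift_to_D_arr[OF assms(1-3,5) \<theta> \<theta>_a] by blast
    have "\<Theta> = euler_restriction (\<alpha> H) \<xi>"
    proof
      fix Y show "\<Theta> Y = euler_restriction (\<alpha> H) \<xi> Y"
      proof (cases "Y \<in> range ?r")
        case True
        then obtain f where Y: "Y = ?r f" by blast
        show ?thesis
          unfolding Y \<Theta>_r euler_restriction_reduce[OF \<xi>(1) assms(2)]
          using \<xi>(2)[of f] by (metis reduce_eq_iff)
      next
        case False
        moreover have "\<Theta> \<in> extensional (range ?r)"
          using \<Theta> unfolding D_restr_iff PiE_def by blast
        ultimately show ?thesis by (simp add: extensional_def euler_restriction_def SH_simps(1))
      qed
    qed
    with \<xi>(1) show "\<Theta> \<in> euler_restriction (\<alpha> H) ` D_arr \<alpha> A" by blast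
  qed
qed

end
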